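(* Let $X,Y$ be recursively presented Polish spaces. Then there is a recursive map $u^{X,Y}_r:(\omega^\omega)^2\to\omega^\omega$ such that for each $1\le\xi<\omega_1$, each $\gamma\in BC_\xi$ and each $\delta\in\omega^\omega$, $u^{X,Y}_r(\gamma,\delta)\in BC_\xi$. Moreover, for $x\in X$, if $\{\delta\}^{X,Y}(x)$ is defined, then $x\in\rho^X[u^{X,Y}_r(\gamma,\delta)]\Leftrightarrow\{\delta\}^{X,Y}(x)\in\rho^Y(\gamma)$.
   Context: Effective notions (recursively presented Polish spaces, recursive functions) are those of Moschovakis' book "Descriptive Set Theory". Each recursively presented Polish space $X$ has its standard effective enumeration $(N(X,k))_{k\in\omega}$ of a neighbourhood basis (possibly with empty sets; $N(X,0)=\emptyset$). $X$ is of type at most $1$ if it is a finite product of spaces equal to $\omega$, $\omega^\omega$ or $2^\omega$. $B\in\Sigma^0_1(X)$ iff $B=\bigcup_{i}N(X,\varepsilon(i))$ for some recursive $\varepsilon:\omega\to\omega$. A map $f:X\to Y$ is recursive if $\{(x,k)\mid f(x)\in N(Y,k)\}\in\Sigma^0_1(X\times\omega)$. Fix a good parametrization: sets $G^X\in\Sigma^0_1(\omega^\omega\times X)$, one for each recursively presented Polish $X$, such that $P\subseteq X$ is open iff $P=G^X_\gamma$ for some $\gamma\in\omega^\omega$, $P$ is $\Sigma^0_1$ iff $P=G^X_\gamma$ for some recursive $\gamma$, and for $X$ of type at most 1 and any $Y$ there is a recursive $S^{X,Y}:\omega^\omega\times X\to\omega^\omega$ with $(\gamma,x,y)\in G^{X\times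 Y}\Leftrightarrow(S^{X,Y}(\gamma,x),y)\in G^Y$. For $\gamma\in\omega^\omega$, $\{\gamma\}^{X,Y}$ is the partial function from $X$ to $Y$ with $\{\gamma\}^{X,Y}(x)$ defined and equal to $y$ iff $y$ is the (unique) point with $\forall k\,[y\in N(Y,k)\Leftrightarrow(\gamma,x,k)\in G^{X\times\omega}]$; write $\{\gamma\}$ when $Y=\omega^\omega$. Borel codes: let $\gamma^*(i):=\gamma(i+1)$. $BC_1:=\{\gamma\in\omega^\omega\mid\gamma(0)=0\}$ and for $2\le\xi<\omega_1$, $BC_\xi:=\{\gamma\in\omega^\omega\mid\gamma(0)=1$ and $\forall i\in\omega$, $\{\gamma^*\}(i)$ is defined and in $\bigcup_{1\le\eta<\xi}BC_\eta\}$; $BC:=\bigcup_{1\le\xi<\omega_1}BC_\xi$. For $\gamma\in BC$, $\rho^X(\gamma):=\bigcup_iN(X,\gamma^*(i))$ if $\gamma\in BC_1$, and $\rho^X(\gamma):=\bigcup_iX\setminus\rho^X(\{\gamma^*\}(i))$ otherwise. *)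

theory Defs
  imports "HOL-Analysis.Analysis"
begin

section \<open>Recursive functions on the natural numbers\<close>

text \<open>\<open>recursive_fun k f\<close>: the restriction of \<open>f\<close> to lists of length \<open>k\<close> is a (total) recursive
  function of \<open>k\<close> arguments. Values on lists of other lengths are irrelevant (rule \<open>ext\<close>).
  Minimalization is only applied to functions for which it yields a total function.\<close>

inductive recursive_fun :: "nat \<Rightarrow> (nat list \<Rightarrow> nat) \<Rightarrow> bool" where
  succ: "recursive_fun 1 (\<lambda>xs. Suc (xs ! 0))"
| const: "recursive_fun k (\<lambda>xs. c)"
| proj: "i < k \<Longrightarrow> recursive_fun k (\<lambda>xs. xs ! i)"
| comp: "recursive_fun m g \<Longrightarrow> (\<And>i. i < m \<Longrightarrow> recursive_fun k (h i)) \<Longrightarrow>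
    recursive_fun k (\<lambda>xs. g (map (\<lambda>i. h i xs) [0..<m]))"
| prim_rec: "recursive_fun k g \<Longrightarrow> recursive_fun (k + 2) h \<Longrightarrow>
    recursive_fun (k + 1) (\<lambda>xs. rec_nat (g (tl xs)) (\<lambda>n v. h (v # n # tl xs)) (hd xs))"
| minim: "recursive_fun (k + 1) g \<Longrightarrow> (\<And>xs. length xs = k \<Longrightarrow> \<exists>n. g (n # xs) = 0) \<Longrightarrow>
    recursive_fun k (\<lambda>xs. LEAST n. g (n # xs) = 0)"
| ext: "recursive_fun k f \<Longrightarrow> (\<And>xs. length xs = k \<Longrightarrow> f xs = g xs) \<Longrightarrow> recursive_fun k g"

definition recursive_rel :: "nat \<Rightarrow> (nat list \<Rightarrow> bool) \<Rightarrow> bool" where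
  "recursive_rel k R \<longleftrightarrow> recursive_fun k (\<lambda>xs. if R xs then 1 else 0)"

definition recursive_seq :: "(nat \<Rightarrow> nat) \<Rightarrow> bool" where
  "recursive_seq \<alpha> \<longleftrightarrow> recursive_fun 1 (\<lambda>xs. \<alpha> (xs ! 0))"

text \<open>Moschovakis' coding of tuples: the product of the \<open>p\<^sub>i\<close> to the power \<open>t\<^sub>i + 1\<close>, where \<open>p\<^sub>i\<close> is the
  \<open>i\<close>-th prime. Then \<open>nth_code u i\<close> is his \<open>(u)\<^sub>i\<close>, which is \<open>0\<close> if \<open>u\<close> is not a code or \<open>i\<close> is
  beyond the length of the coded tuple.\<close>

definition tuple_code :: "nat list \<Rightarrow> nat" where
  "tuple_code ts = (\<Prod>i<length ts. enumerate {p. prime p} i ^ (ts ! i + 1))"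

definition nth_code :: "nat \<Rightarrow> nat \<Rightarrow> nat" where
  "nth_code u i =
    (if \<exists>ts. u = tuple_code ts \<and> i < length ts then (THE ts. u = tuple_code ts) ! i else 0)"


section \<open>Recursively presented Polish spaces\<close>

text \<open>A space is given by its set of points, a metric and a sequence of points.\<close>

record 'a pspace =
  pts :: "'a set"
  metr :: "'a \<Rightarrow> 'a \<Rightarrow> real"
  dseq :: "nat \<Rightarrow> 'a"

definition rec_presented :: "'a pspace \<Rightarrow> bool" where
  "rec_presented X \<longleftrightarrow>
     Metric_space (pts X) (metr X) \<and>
     Metric_space.mcomplete (pts X) (metr X) \<and>
     range (dseq X) \<subseteq> pts X \<and>
     Metric_space.mtopology (pts X) (metr X) closure_of range (dseq X) = pts X \<and>
     recursive_rel 4 (\<lambda>xs. metr X (dseq X (xs ! 0)) (dseq X (xs ! 1)) \<le> real (xs ! 2) / (real (xs ! 3) + 1)) \<and>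
     recursive_rel 4 (\<lambda>xs. metr X (dseq X (xs ! 0)) (dseq X (xs ! 1)) < real (xs ! 2) / (real (xs ! 3) + 1))"

definition nbhd :: "'a pspace \<Rightarrow> nat \<Rightarrow> 'a set" where
  "nbhd X s = Metric_space.mball (pts X) (metr X)
     (dseq X (nth_code s 0)) (real (nth_code s 1) / (real (nth_code s 2) + 1))"

definition Sigma01 :: "'a pspace \<Rightarrow> 'a set set" where
  "Sigma01 X = {B. \<exists>\<epsilon>. recursive_seq \<epsilon> \<and> B = (\<Union>i. nbhd X (\<epsilon> i))}"

text \<open>Good parametrizations and Borel codes refer to a family of sets indexed by all
  recursively presented Polish spaces, which must therefore live in one type closed under the
  formation of products. The points of the spaces below are those of an arbitrary type \<open>'a\<close>
  (\<open>Atom\<close>), the natural numbers (\<open>Num\<close>), the elements of Baire space (\<open>Fn\<close>) and all pairs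
  formed from these (\<open>Tup\<close>).\<close>

datatype 'a point = Atom 'a | Num nat | Fn "nat \<Rightarrow> nat" | Tup "'a point" "'a point"

type_synonym 'a space = "'a point pspace"

text \<open>Off the respective sets of points, the metrics are given the dummy value \<open>0\<close>.
  Products carry the maximum metric; products of more than two factors are nested to the right,
  e.g. \<open>X \<times>\<^sub>r (Y \<times>\<^sub>r Z)\<close>.\<close>

definition omega :: "'a space" where
  "omega = \<lparr> pts = range Num,
     metr = (\<lambda>p q. case (p, q) of (Num m, Num n) \<Rightarrow> if m = n then 0 else 1 | _ \<Rightarrow> 0),
     dseq = Num \<rparr>"

definition baire_metric :: "'a point \<Rightarrow> 'a point \<Rightarrow> real" where
  "baire_metric p q = (case (p, q) of
     (Fn \<alpha>, Fn \<beta>) \<Rightarrow> if \<alpha> = \<beta> then 0 else 1 / (real (LEAST n. \<alpha> n \<noteq> \<beta> n) + 1)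
   | _ \<Rightarrow> 0)"

definition baire :: "'a space" where
  "baire = \<lparr> pts = range Fn, metr = baire_metric, dseq = (\<lambda>i. Fn (nth_code i)) \<rparr>"

definition cantor :: "'a space" where
  "cantor = \<lparr> pts = Fn ` {\<alpha>. \<forall>n. \<alpha> n \<in> {0, 1}}, metr = baire_metric,
     dseq = (\<lambda>i. Fn (\<lambda>n. min 1 (nth_code i n))) \<rparr>"

definition prod_space :: "'a space \<Rightarrow> 'a space \<Rightarrow> 'a space"  (infixr "\<times>\<^sub>r" 75) where
  "X \<times>\<^sub>r Y = \<lparr> pts = {Tup x y | x y. x \<in> pts X \<and> y \<in> pts Y},
     metr = (\<lambda>p q. case (p, q) of
        (Tup x y, Tup x' y') \<Rightarrow> max (metr X x x') (metr Y y y') | _ \<Rightarrow> 0),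
     dseq = (\<lambda>i. Tup (dseq X (nth_code i 0)) (dseq Y (nth_code i 1))) \<rparr>"

inductive type_le_1 :: "'a space \<Rightarrow> bool" where
  "type_le_1 omega"
| "type_le_1 baire"
| "type_le_1 cantor"
| "type_le_1 X \<Longrightarrow> type_le_1 Y \<Longrightarrow> type_le_1 (X \<times>\<^sub>r Y)"

definition recursive_map :: "'a space \<Rightarrow> 'a space \<Rightarrow> ('a point \<Rightarrow> 'a point) \<Rightarrow> bool" where
  "recursive_map X Y f \<longleftrightarrow> f \<in> pts X \<rightarrow> pts Y \<and>
     {Tup x (Num k) | x k. x \<in> pts X \<and> f x \<in> nbhd Y k} \<in> Sigma01 (X \<times>\<^sub>r omega)"

fun on_points :: "((nat \<Rightarrow> nat) \<Rightarrow> (nat \<Rightarrow> nat) \<Rightarrow> nat \<Rightarrow> nat) \<Rightarrow> 'a point \<Rightarrow> 'a point" where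
  "on_points u (Tup (Fn \<gamma>) (Fn \<delta>)) = Fn (u \<gamma> \<delta>)"
| "on_points u _ = undefined"


section \<open>Good parametrizations and partial functions\<close>

definition section_at :: "('a space \<Rightarrow> 'a point set) \<Rightarrow> 'a space \<Rightarrow> (nat \<Rightarrow> nat) \<Rightarrow> 'a point set" where
  "section_at G X \<gamma> = {x. Tup (Fn \<gamma>) x \<in> G X}"

definition good_parametrization :: "('a space \<Rightarrow> 'a point set) \<Rightarrow> bool" where
  "good_parametrization G \<longleftrightarrow>
     (\<forall>X. rec_presented X \<longrightarrow>
        G X \<in> Sigma01 (baire \<times>\<^sub>r X) \<and>
        (\<forall>P \<subseteq> pts X. openin (Metric_space.mtopology (pts X) (metr X)) P \<longleftrightarrow>
           (\<exists>\<gamma>. P = section_at G X \<gamma>)) \<and>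
        (\<forall>P \<subseteq> pts X. P \<in> Sigma01 X \<longleftrightarrow>
           (\<exists>\<gamma>. recursive_seq \<gamma> \<and> P = section_at G X \<gamma>))) \<and>
     (\<forall>X Y. type_le_1 X \<longrightarrow> rec_presented Y \<longrightarrow>
        (\<exists>S. recursive_map (baire \<times>\<^sub>r X) baire S \<and>
           (\<forall>\<gamma>. \<forall>x \<in> pts X. \<forall>y \<in> pts Y.
              Tup (Fn \<gamma>) (Tup x y) \<in> G (X \<times>\<^sub>r Y) \<longleftrightarrow> Tup (S (Tup (Fn \<gamma>) x)) y \<in> G Y)))"

definition is_value :: "('a space \<Rightarrow> 'a point set) \<Rightarrow> 'a space \<Rightarrow> 'a space \<Rightarrow>
    (nat \<Rightarrow> nat) \<Rightarrow> 'a point \<Rightarrow> 'a point \<Rightarrow> bool" where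
  "is_value G X Y \<gamma> x y \<longleftrightarrow> x \<in> pts X \<and> y \<in> pts Y \<and>
     (\<forall>k. y \<in> nbhd Y k \<longleftrightarrow> Tup (Fn \<gamma>) (Tup x (Num k)) \<in> G (X \<times>\<^sub>r omega))"

text \<open>The partial function \<open>{\<gamma>}\<^sup>X\<^sup>,\<^sup>Y\<close>.\<close>

definition pfun :: "('a space \<Rightarrow> 'a point set) \<Rightarrow> 'a space \<Rightarrow> 'a space \<Rightarrow>
    (nat \<Rightarrow> nat) \<Rightarrow> 'a point \<Rightarrow> 'a point option" where
  "pfun G X Y \<gamma> x =
     (if \<exists>!y. is_value G X Y \<gamma> x y then Some (THE y. is_value G X Y \<gamma> x y) else None)"

definition tail :: "(nat \<Rightarrow> nat) \<Rightarrow> nat \<Rightarrow> nat" where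
  "tail \<gamma> i = \<gamma> (i + 1)"

text \<open>\<open>subcode G \<gamma> i \<epsilon>\<close>: \<open>{\<gamma>\<^sup>*}(i)\<close> is defined and equal to \<open>\<epsilon>\<close>.\<close>

definition subcode :: "('a space \<Rightarrow> 'a point set) \<Rightarrow> (nat \<Rightarrow> nat) \<Rightarrow> nat \<Rightarrow> (nat \<Rightarrow> nat) \<Rightarrow> bool" where
  "subcode G \<gamma> i \<epsilon> \<longleftrightarrow> pfun G omega baire (tail \<gamma>) (Num i) = Some (Fn \<epsilon>)"

lemma subcode_unique: "subcode G \<gamma> i \<epsilon> \<Longrightarrow> subcode G \<gamma> i \<epsilon>' \<Longrightarrow> \<epsilon> = \<epsilon>'"
  by (simp add: subcode_def)


section \<open>The countable ordinals\<close>

text \<open>The cardinal successor of \<open>\<aleph>\<^sub>0\<close> is a well-order of type \<open>\<omega>\<^sub>1\<close>, so the elements of the following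
  type are the ordinals below \<open>\<omega>\<^sub>1\<close>, in their usual order. In particular \<open>0\<close> is the least element
  and \<open>1\<close> is the next one.\<close>

lemma Well_order_cardSuc_natLeq: "Well_order (cardSuc natLeq)"
  by (simp add: cardSuc_Well_order natLeq_Card_order)

lemma infinite_Field_cardSuc_natLeq: "infinite (Field (cardSuc natLeq))"
  using cardSuc_finite[OF natLeq_Card_order] by (simp add: Field_natLeq)

typedef countable_ordinal = "Field (cardSuc natLeq)"
  using infinite_Field_cardSuc_natLeq by (metis ex_in_conv finite.emptyI)

instantiation countable_ordinal :: wellorder
begin

definition "\<xi> \<le> \<eta> \<longleftrightarrow> (Rep_countable_ordinal \<xi>, Rep_countable_ordinal \<eta>) \<in> cardSuc natLeq"
definition "\<xi> < \<eta> \<longleftrightarrow> \<xi> \<le> \<eta> \<and> \<xi> \<noteq> (\<eta> :: countable_ordinal)"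

instance
proof
  note wo = Well_order_cardSuc_natLeq[unfolded well_order_on_def linear_order_on_def
      partial_order_on_def preorder_on_def]
  fix x y z :: countable_ordinal
  have anti: "x = y" if "x \<le> y" "y \<le> x" for x y :: countable_ordinal
    using that wo unfolding less_eq_countable_ordinal_def
    by (meson Rep_countable_ordinal_inject antisymD)
  then show "x \<le> y \<Longrightarrow> y \<le> x \<Longrightarrow> x = y" .
  have refl: "x \<le> x" for x :: countable_ordinal
    using wo Rep_countable_ordinal[of x] unfolding less_eq_countable_ordinal_def by (blast dest: refl_onD)
  show "x < y \<longleftrightarrow> x \<le> y \<and> \<not> y \<le> x"
    using anti refl unfolding less_countable_ordinal_def by blast
  show "x \<le> x" by (rule refl)
  show "x \<le> y \<Longrightarrow> y \<le> z \<Longrightarrow> x \<le> z"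
    using wo unfolding less_eq_countable_ordinal_def by (meson transD)
  show "x \<le> y \<or> y \<le> x"
    using wo Rep_countable_ordinal[of x] Rep_countable_ordinal[of y] refl[of x]
    unfolding less_eq_countable_ordinal_def total_on_def by metis
next
  fix P and a :: countable_ordinal
  assume step: "\<And>x. (\<And>y. y < x \<Longrightarrow> P y) \<Longrightarrow> P (x :: countable_ordinal)"
  have "wf (inv_image (cardSuc natLeq - Id) Rep_countable_ordinal)"
    using Well_order_cardSuc_natLeq by (simp add: well_order_on_def)
  then show "P a"
  proof (induction a rule: wf_induct_rule)
    case (less x)
    show "P x"
    proof (rule step)
      fix y :: countable_ordinal
      assume "y < x"
      then show "P y"
        by (intro less) (simp add: less_countable_ordinal_def less_eq_countable_ordinal_def
            Rep_countable_ordinal_inject)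
    qed
  qed
qed

end

instantiation countable_ordinal :: "{zero, one}"
begin

definition "0 = (LEAST \<xi> :: countable_ordinal. True)"
definition "1 = (LEAST \<xi> :: countable_ordinal. 0 < \<xi>)"

instance ..

end

lemma countable_iff_ordLeq_natLeq:
  includes cardinal_syntax
  shows "countable A \<longleftrightarrow> |A| \<le>o natLeq"
proof -
  have "countable A \<longleftrightarrow> |A| \<le>o |UNIV :: nat set|"
    by (simp add: countable_def card_of_ordLeq[symmetric])
  also have "\<dots> \<longleftrightarrow> |A| \<le>o natLeq"
    using card_of_nat ordIso_symmetric ordLeq_ordIso_trans by blast
  finally show ?thesis .
qed

lemma uncountable_countable_ordinals:
  includes cardinal_syntax
  shows "uncountable (UNIV :: countable_ordinal set)"
proof
  assume "countable (UNIV :: countable_ordinal set)"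
  then have "countable (Field (cardSuc natLeq))"
    using type_definition.univ[OF type_definition_countable_ordinal]
    by (metis countable_image type_definition.Rep_range[OF type_definition_countable_ordinal])
  then have "|Field (cardSuc natLeq)| \<le>o natLeq"
    by (simp add: countable_iff_ordLeq_natLeq)
  moreover have "|Field (cardSuc natLeq)| =o cardSuc natLeq"
    by (simp add: card_of_Field_ordIso cardSuc_Card_order natLeq_Card_order)
  ultimately have "cardSuc natLeq \<le>o natLeq"
    using ordIso_ordLeq_trans ordIso_symmetric by blast
  then show False
    using cardSuc_greater[OF natLeq_Card_order] not_ordLess_ordLeq by blast
qed

lemma countable_below_countable_ordinal:
  includes cardinal_syntax
  shows "countable {\<eta> :: countable_ordinal. \<eta> < \<xi>}"
proof -
  let ?r = "cardSuc natLeq" and ?x = "Rep_countable_ordinal \<xi>"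
  have "|underS ?r ?x| <o ?r"
    by (intro card_of_underS Rep_countable_ordinal cardSuc_Card_order natLeq_Card_order)
  then have "|underS ?r ?x| \<le>o natLeq"
    using cardSuc_ordLeq_ordLess card_of_Card_order natLeq_Card_order by blast
  then have "countable (underS ?r ?x)"
    by (simp add: countable_iff_ordLeq_natLeq)
  moreover have "Rep_countable_ordinal ` {\<eta>. \<eta> < \<xi>} \<subseteq> underS ?r ?x"
    by (auto simp: underS_def less_countable_ordinal_def less_eq_countable_ordinal_def
        Rep_countable_ordinal_inject)
  ultimately show ?thesis
    by (metis countable_subset countable_image_inj_on inj_on_subset[OF _ subset_UNIV]
        injI Rep_countable_ordinal_inject)
qed

lemma zero_least_countable_ordinal: "(0 :: countable_ordinal) \<le> \<xi>"
  unfolding zero_countable_ordinal_def by (rule Least_le) simp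

lemma zero_less_one_countable_ordinal: "(0 :: countable_ordinal) < 1"
proof -
  have "\<exists>\<xi> :: countable_ordinal. 0 < \<xi>"
  proof (rule ccontr)
    assume "\<nexists>\<xi> :: countable_ordinal. 0 < \<xi>"
    then have "(UNIV :: countable_ordinal set) = {0}"
      by (metis UNIV_eq_I singletonI zero_least_countable_ordinal order_le_less)
    then show False
      using uncountable_countable_ordinals by (metis countable_empty countable_insert)
  qed
  then show ?thesis
    unfolding one_countable_ordinal_def by (rule LeastI_ex)
qed

lemma one_least_countable_ordinal: "0 < \<xi> \<Longrightarrow> (1 :: countable_ordinal) \<le> \<xi>"
  unfolding one_countable_ordinal_def by (rule Least_le)


section \<open>Borel codes\<close>

function BC_level :: "('a space \<Rightarrow> 'a point set) \<Rightarrow> countable_ordinal \<Rightarrow> (nat \<Rightarrow> nat) set" where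
  "BC_level G \<xi> =
     (if \<xi> = 0 then {}
      else if \<xi> = 1 then {\<gamma>. \<gamma> 0 = 0}
      else {\<gamma>. \<gamma> 0 = 1 \<and> (\<forall>i. \<exists>\<epsilon>. subcode G \<gamma> i \<epsilon> \<and> \<epsilon> \<in> (\<Union>\<eta>\<in>{1..<\<xi>}. BC_level G \<eta>))})"
  by pat_completeness auto
termination
  by (relation "inv_image {(\<eta>, \<xi>). \<eta> < \<xi>} snd") (auto simp: wf)

declare BC_level.simps [simp del]

definition BC :: "('a space \<Rightarrow> 'a point set) \<Rightarrow> (nat \<Rightarrow> nat) set" where
  "BC G = (\<Union>\<xi>\<in>{1..}. BC_level G \<xi>)"

lemma BC_levelE:
  assumes "\<gamma> \<in> BC_level G \<xi>" "\<gamma> \<notin> BC_level G 1"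
  obtains \<epsilon> \<eta> where "subcode G \<gamma> i \<epsilon>" "1 \<le> \<eta>" "\<eta> < \<xi>" "\<epsilon> \<in> BC_level G \<eta>"
proof -
  have "BC_level G 0 = {}"
    by (subst BC_level.simps) simp
  then have "\<xi> \<noteq> 1" "\<xi> \<noteq> 0"
    using assms by (metis, metis empty_iff)
  then have "\<forall>i. \<exists>\<epsilon>. subcode G \<gamma> i \<epsilon> \<and> \<epsilon> \<in> (\<Union>\<eta>\<in>{1..<\<xi>}. BC_level G \<eta>)"
    using assms(1) by (subst (asm) BC_level.simps) simp
  then show thesis
    using that by (meson UN_E atLeastLessThan_iff)
qed

text \<open>Outside \<open>BC G\<close>, the interpretation \<open>\<rho>\<^sup>X\<close> has the dummy value \<open>{}\<close>.\<close>

function rho :: "('a space \<Rightarrow> 'a point set) \<Rightarrow> 'a space \<Rightarrow> (nat \<Rightarrow> nat) \<Rightarrow> 'a point set" where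
  "rho G X \<gamma> =
     (if \<gamma> \<notin> BC G then {}
      else if \<gamma> \<in> BC_level G 1 then (\<Union>i. nbhd X (tail \<gamma> i))
      else (\<Union>i. pts X - rho G X (THE \<epsilon>. subcode G \<gamma> i \<epsilon>)))"
  by pat_completeness auto
termination
proof (relation "inv_image {(\<eta>, \<xi>). \<eta> < \<xi>} (\<lambda>(G, X, \<gamma>). LEAST \<xi>. 1 \<le> \<xi> \<and> \<gamma> \<in> BC_level G \<xi>)")
  show "wf (inv_image {(\<eta>, \<xi>). \<eta> < \<xi>}
      (\<lambda>(G :: 'a space \<Rightarrow> 'a point set, X :: 'a space, \<gamma>). LEAST \<xi>. 1 \<le> \<xi> \<and> \<gamma> \<in> BC_level G \<xi>))"
    by (simp add: wf)
next
  fix G :: "'a space \<Rightarrow> 'a point set" and X :: "'a space" and \<gamma> i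
  assume "\<not> \<gamma> \<notin> BC G" and not_1: "\<gamma> \<notin> BC_level G 1"
  let ?rank = "\<lambda>\<gamma>. LEAST \<xi>. 1 \<le> \<xi> \<and> \<gamma> \<in> BC_level G \<xi>"
  have "\<exists>\<xi>. 1 \<le> \<xi> \<and> \<gamma> \<in> BC_level G \<xi>"
    using \<open>\<not> \<gamma> \<notin> BC G\<close> by (auto simp: BC_def)
  then have "\<gamma> \<in> BC_level G (?rank \<gamma>)"
    by (metis (mono_tags, lifting) LeastI_ex)
  then obtain \<epsilon> \<eta> where \<epsilon>: "subcode G \<gamma> i \<epsilon>" and \<eta>: "1 \<le> \<eta>" "\<eta> < ?rank \<gamma>" "\<epsilon> \<in> BC_level G \<eta>"
    using not_1 by (rule BC_levelE)
  have "(THE \<epsilon>. subcode G \<gamma> i \<epsilon>) = \<epsilon>"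
    using \<epsilon> subcode_unique by blast
  moreover have "?rank \<epsilon> \<le> \<eta>"
    using \<eta> by (simp add: Least_le)
  ultimately show "((G, X, THE \<epsilon>. subcode G \<gamma> i \<epsilon>), (G, X, \<gamma>)) \<in>
      inv_image {(\<eta>, \<xi>). \<eta> < \<xi>} (\<lambda>(G, X, \<gamma>). LEAST \<xi>. 1 \<le> \<xi> \<and> \<gamma> \<in> BC_level G \<xi>)"
    using \<eta>(2) by simp
qed

declare rho.simps [simp del]

end

(* The map u is found by the recursion theorem. If \<gamma>(0) = 0, then x \<in> \<rho>(u(\<gamma>,\<delta>)) must mean that
   (\<delta>,x,\<gamma>(i+1)) \<in> G for some i, and since G is a recursive union of basic neighbourhoods, a code of
   this open set is computable from \<gamma> and \<delta>. Otherwise, u(\<gamma>,\<delta>) has to code the partial function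
   i \<mapsto> u({\<gamma>*}(i),\<delta>). For a parameter \<epsilon>, let v(\<epsilon>,\<gamma>,\<delta>) be the above code in the first case and
   1 followed by S(\<epsilon>,(\<epsilon>,\<gamma>,\<delta>)) in the second one. The relation "v(\<epsilon>,{\<gamma>*}(i),\<delta>) \<in> N(k)" is
   semirecursive in (\<epsilon>,\<gamma>,\<delta>,i,k) as long as {\<gamma>*}(i) is defined, so it is the section of G at some
   recursive \<epsilon>\<^sub>0, and u(\<gamma>,\<delta>) = v(\<epsilon>\<^sub>0,\<gamma>,\<delta>) works, by induction on the level of \<gamma>.

   To see that the relations involved are semirecursive, points of products of \<omega> and Baire space are
   coded by single sequences, and \<Sigma>\<^sup>0\<^sub>1 sets are replaced by relations that are semirecursive in such a
   sequence as an oracle. *)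
theory Submission
  imports Defs
begin

section \<open>Computable functions of environments\<close>

text \<open>The value {\<gamma>*}(i) may be undefined, whereas u must be total. For this reason v
  never evaluates a subcode: it inspects \<gamma>(0) only, and otherwise writes down, through the
  total map S, an index of the function that evaluates the subcodes later. Complements and countable
  unions commute with preimages, and each subcode keeps its level, so all real work is in the open
  case. That work takes place in X, an arbitrary space whose points cannot serve as oracles. The
  maximum metric is the way out: a ball of the product of Baire space, X and \<omega> is a product
  of three balls of one radius, so its section at given \<delta> and k is empty or a ball of X, and
  which of these holds is decidable in \<delta> and k. Codes of balls of X are manipulated, never
  points of X.\<close>

text \<open>Functions of several numbers are rendered as functions of an environment \<open>e\<close> that depend only on
  \<open>e 0, \<dots>, e (k - 1)\<close> for some \<open>k\<close>. In the rules for binders below, the bound variable becomes \<open>e 0\<close> and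
  the other variables are shifted, as with de Bruijn indices.\<close>

definition computable :: "((nat \<Rightarrow> nat) \<Rightarrow> nat) \<Rightarrow> bool" where
  "computable f \<longleftrightarrow> (\<exists>k g. recursive_fun k g \<and> (\<forall>e. f e = g (map e [0..<k])))"

definition decidable :: "((nat \<Rightarrow> nat) \<Rightarrow> bool) \<Rightarrow> bool" where
  "decidable P \<longleftrightarrow> computable (\<lambda>e. of_bool (P e))"

lemma computable_var: "computable (\<lambda>e. e i)"
  unfolding computable_def
  by (intro exI[of _ "Suc i"] exI[of _ "\<lambda>xs. xs ! i"] conjI recursive_fun.proj)
    (auto simp del: upt_Suc)

lemma computable_const: "computable (\<lambda>e. c)"
  unfolding computable_def
  by (intro exI[of _ 0] exI[of _ "\<lambda>xs. c"] conjI recursive_fun.const) auto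

text \<open>A function of k arguments can be read as one of any l >= k arguments that ignores the
  rest. This brings finitely many functions to a common arity, as \<open>recursive_fun.comp\<close>
  and \<open>recursive_fun.prim_rec\<close> demand.\<close>

lemma computable_iff_eventually:
  "computable f \<longleftrightarrow> (\<exists>k. \<forall>l\<ge>k. \<exists>g. recursive_fun l g \<and> (\<forall>e. f e = g (map e [0..<l])))"
proof
  assume "computable f"
  then obtain k g where g: "recursive_fun k g" "\<And>e. f e = g (map e [0..<k])"
    unfolding computable_def by blast
  show "\<exists>k. \<forall>l\<ge>k. \<exists>g. recursive_fun l g \<and> (\<forall>e. f e = g (map e [0..<l]))"
  proof (intro exI allI impI conjI)
    fix l assume l: "k \<le> l"
    show "recursive_fun l (\<lambda>xs. g (map (\<lambda>i. xs ! i) [0..<k]))"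
      using l by (intro recursive_fun.comp[of k] recursive_fun.proj g) auto
    fix e :: "nat \<Rightarrow> nat"
    have "map (\<lambda>i. map e [0..<l] ! i) [0..<k] = map e [0..<k]"
      using l by (intro map_cong) auto
    then show "f e = g (map (\<lambda>i. map e [0..<l] ! i) [0..<k])"
      by (simp only: g(2))
  qed
next
  assume "\<exists>k. \<forall>l\<ge>k. \<exists>g. recursive_fun l g \<and> (\<forall>e. f e = g (map e [0..<l]))"
  then show "computable f"
    unfolding computable_def by blast
qed

lemma computable_subst:
  assumes "computable f" "\<And>i. computable (h i)"
  shows "computable (\<lambda>e. f (\<lambda>i. h i e))"
proof -
  obtain k g where g: "recursive_fun k g" "\<And>e. f e = g (map e [0..<k])"
    using assms(1) unfolding computable_def by blast
  have "\<forall>i. \<exists>K. \<forall>l\<ge>K. \<exists>g. recursive_fun l g \<and> (\<forall>e. h i e = g (map e [0..<l]))"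
    using assms(2) unfolding computable_iff_eventually by blast
  then obtain K where K: "\<And>i l. l \<ge> K i \<Longrightarrow> \<exists>g. recursive_fun l g \<and> (\<forall>e. h i e = g (map e [0..<l]))"
    by metis
  \<comment> \<open>Only the first k members of the family \<open>h\<close> matter, so a maximum of
    finitely many arities suffices although the family is infinite.\<close>
  define l where "l = Max (insert 0 (K ` {..<k}))"
  have "l \<ge> K i" if "i < k" for i
    unfolding l_def using that by (intro Max_ge) auto
  then have "\<forall>i. \<exists>g. i < k \<longrightarrow> recursive_fun l g \<and> (\<forall>e. h i e = g (map e [0..<l]))"
    using K by blast
  then obtain H where H: "\<And>i. i < k \<Longrightarrow> recursive_fun l (H i)"
    "\<And>i e. i < k \<Longrightarrow> h i e = H i (map e [0..<l])"
    by metis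
  have "recursive_fun l (\<lambda>xs. g (map (\<lambda>i. H i xs) [0..<k]))"
    by (rule recursive_fun.comp[OF g(1) H(1)])
  moreover have "f (\<lambda>i. h i e) = g (map (\<lambda>i. H i (map e [0..<l])) [0..<k])" for e
    unfolding g(2) by (intro arg_cong[of _ _ g] map_cong) (auto simp: H(2))
  ultimately show ?thesis unfolding computable_def by blast
qed

lemma computable_recursive_fun:
  "recursive_fun k g \<Longrightarrow> computable (\<lambda>e. g (map e [0..<k]))"
  unfolding computable_def by blast

lemma computable_apply1:
  assumes "computable (\<lambda>e. f (e 0))" "computable a"
  shows "computable (\<lambda>e. f (a e))"
  using computable_subst[OF assms(1), of "\<lambda>_. a"] assms(2) by simp

lemma computable_apply2:
  assumes "computable (\<lambda>e. f (e 0) (e 1))" "computable a" "computable b"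
  shows "computable (\<lambda>e. f (a e) (b e))"
  using computable_subst[OF assms(1), of "\<lambda>i. if i = 0 then a else b"] assms(2,3) by simp

lemma computable_Suc: "computable f \<Longrightarrow> computable (\<lambda>e. Suc (f e))"
  using computable_apply1[OF _, of Suc f] computable_recursive_fun[OF recursive_fun.succ] by simp

lemma computable_rec_nat:
  assumes "computable n" "computable a" "computable (\<lambda>e. b (e 0) (e 1) (\<lambda>i. e (Suc (Suc i))))"
  shows "computable (\<lambda>e. rec_nat (a e) (\<lambda>i v. b i v e) (n e))"
proof -
  obtain k where k: "\<And>l. l \<ge> k \<Longrightarrow> \<exists>g. recursive_fun l g \<and> (\<forall>e. a e = g (map e [0..<l]))"
    using assms(2) unfolding computable_iff_eventually by blast
  obtain k' where k': "\<And>l. l \<ge> k' \<Longrightarrow> \<exists>g. recursive_fun l g \<and>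
      (\<forall>e. b (e 0) (e 1) (\<lambda>i. e (Suc (Suc i))) = g (map e [0..<l]))"
    using assms(3) unfolding computable_iff_eventually by blast
  define l where "l = max k k'"
  obtain ga where ga: "recursive_fun l ga" "\<And>e. a e = ga (map e [0..<l])"
    using k[of l] l_def by auto
  obtain gb where gb: "recursive_fun (l + 2) gb"
    "\<And>e. b (e 0) (e 1) (\<lambda>i. e (Suc (Suc i))) = gb (map e [0..<l+2])"
    using k'[of "l + 2"] l_def by (metis le_add1 max.cobounded2 order_trans)
  have b: "b v i e = gb (v # i # map e [0..<l])" for i v e
    using gb(2)[of "case_nat v (case_nat i e)"]
    by (simp add: map_upt_Suc del: upt_Suc)
  \<comment> \<open>\<open>recursive_fun.prim_rec\<close> passes the accumulated value before the
    counter, while the rule proved here binds the counter as \<open>e 0\<close> and the value as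
    \<open>e 1\<close>.\<close>
  define swap where "swap j = (if j = 0 then 1 else if j = 1 then 0 else j)" for j :: nat
  have swap: "map (\<lambda>j. (v # i # xs) ! swap j) [0..<l+2] = i # v # xs" if "length xs = l" for v i and xs :: "nat list"
    using that by (intro nth_equalityI) (auto simp: swap_def nth_Cons' simp del: upt_Suc)
  have "recursive_fun (l + 2) (\<lambda>xs. gb (map (\<lambda>j. xs ! swap j) [0..<l+2]))"
    by (intro recursive_fun.comp[OF gb(1)] recursive_fun.proj) (auto simp: swap_def)
  then have "recursive_fun (l + 1) (\<lambda>xs. rec_nat (ga (tl xs))
      (\<lambda>n v. gb (map (\<lambda>j. (v # n # tl xs) ! swap j) [0..<l+2])) (hd xs))"
    by (rule recursive_fun.prim_rec[OF ga(1)])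
  then have "recursive_fun (l + 1) (\<lambda>xs. rec_nat (ga (tl xs)) (\<lambda>n v. gb (n # v # tl xs)) (hd xs))"
    by (rule recursive_fun.ext) (simp only: swap length_tl add_diff_cancel_right')
  from computable_recursive_fun[OF this]
  have 1: "computable (\<lambda>e. rec_nat (a (\<lambda>i. e (Suc i))) (\<lambda>i v. b i v (\<lambda>i. e (Suc i))) (e 0))"
    by (simp add: b ga(2) map_upt_Suc del: upt_Suc)
  show ?thesis
    using computable_subst[OF 1, of "case_nat n (\<lambda>i e. e i)"]
    by (auto simp: assms(1) computable_var split: nat.splits)
qed

lemma computable_Least:
  assumes "decidable (\<lambda>e. P (e 0) (\<lambda>i. e (Suc i)))" "\<And>e. \<exists>n. P n e"
  shows "computable (\<lambda>e. LEAST n. P n e)"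
proof -
  \<comment> \<open>\<open>recursive_fun.minim\<close> searches for a zero, so the characteristic
    function is negated, by a recursion of length 0 or 1.\<close>
  have "computable (\<lambda>e. rec_nat 1 (\<lambda>i v. 0) (of_bool (P (e 0) (\<lambda>i. e (Suc i)))))"
    using assms(1) unfolding decidable_def
    by (intro computable_rec_nat computable_const)
  then obtain k where k: "\<And>l. l \<ge> k \<Longrightarrow> \<exists>g. recursive_fun l g \<and>
      (\<forall>e. rec_nat 1 (\<lambda>i v. 0) (of_bool (P (e 0) (\<lambda>i. e (Suc i)))) = g (map e [0..<l]))"
    unfolding computable_iff_eventually by blast
  obtain g where g: "recursive_fun (k + 1) g"
    "\<And>e. rec_nat 1 (\<lambda>i v. 0) (of_bool (P (e 0) (\<lambda>i. e (Suc i)))) = g (map e [0..<k+1])"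
    using k[of "k + 1"] by auto
  have P: "P n e \<longleftrightarrow> g (n # map e [0..<k]) = 0" for n e
    using g(2)[of "case_nat n e"]
    by (cases "P n e") (simp_all add: map_upt_Suc del: upt_Suc)
  have "recursive_fun k (\<lambda>xs. LEAST n. g (n # xs) = 0)"
  proof (rule recursive_fun.minim[OF g(1)])
    fix xs :: "nat list" assume "length xs = k"
    then have "map (\<lambda>i. xs ! i) [0..<k] = xs" by (metis map_nth)
    then show "\<exists>n. g (n # xs) = 0"
      using assms(2)[of "\<lambda>i. xs ! i"] unfolding P by simp
  qed
  from computable_recursive_fun[OF this] show ?thesis
    unfolding P .
qed

section \<open>Case distinction, arithmetic and decidable predicates\<close>

lemma computable_of_bool: "decidable P \<Longrightarrow> computable (\<lambda>e. of_bool (P e))"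
  by (simp add: decidable_def)

lemma computable_if:
  assumes "decidable P" "computable a" "computable b"
  shows "computable (\<lambda>e. if P e then a e else b e)"
proof -
  have "computable (\<lambda>e. rec_nat (b e) (\<lambda>i v. a e) (of_bool (P e)))"
    using assms unfolding decidable_def
    by (intro computable_rec_nat) (auto intro: computable_subst[where h = "\<lambda>i e. e (Suc (Suc i))"] computable_var)
  then show ?thesis by (rule back_subst[of computable]) auto
qed

lemma computable_add:
  assumes "computable a" "computable b"
  shows "computable (\<lambda>e. a e + b e)"
proof -
  have "computable (\<lambda>e. rec_nat (a e) (\<lambda>i v. Suc v) (b e))"
    using assms by (intro computable_rec_nat computable_Suc computable_var)
  moreover have "rec_nat m (\<lambda>i v. Suc v) n = m + n" for m n
    by (induction n) auto
  ultimately show ?thesis by simp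
qed

lemma computable_weaken: "computable f \<Longrightarrow> computable (\<lambda>e. f (\<lambda>i. e (Suc i)))"
  by (erule computable_subst) (rule computable_var)

lemma computable_mult:
  assumes "computable a" "computable b"
  shows "computable (\<lambda>e. a e * b e)"
proof -
  have "computable (\<lambda>e. rec_nat 0 (\<lambda>i v. v + a e) (b e))"
    using assms by (intro computable_rec_nat computable_add computable_var computable_const
       computable_weaken[OF computable_weaken])
  moreover have "rec_nat 0 (\<lambda>i v. v + m) n = m * n" for m n :: nat
    by (induction n) auto
  ultimately show ?thesis by simp
qed

lemma computable_power:
  assumes "computable a" "computable b"
  shows "computable (\<lambda>e. a e ^ b e)"
proof -
  have "computable (\<lambda>e. rec_nat 1 (\<lambda>i v. a e * v) (b e))"
    using assms by (intro computable_rec_nat computable_mult computable_var computable_const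
       computable_weaken[OF computable_weaken])
  moreover have "rec_nat 1 (\<lambda>i v. m * v) n = m ^ n" for m n :: nat
    by (induction n) auto
  ultimately show ?thesis by simp
qed

lemma computable_diff:
  assumes "computable a" "computable b"
  shows "computable (\<lambda>e. a e - b e)"
proof -
  have "computable (\<lambda>e. rec_nat 0 (\<lambda>i v. i) (e 0))"
    by (intro computable_rec_nat computable_var computable_const)
  moreover have "rec_nat 0 (\<lambda>i v. i) n = n - 1" for n :: nat
    by (induction n) auto
  ultimately have pred: "computable (\<lambda>e. e 0 - 1)" by simp
  have "computable (\<lambda>e. rec_nat (a e) (\<lambda>i v. v - 1) (b e))"
    using assms by (intro computable_rec_nat computable_var
       computable_apply1[OF pred])
  moreover have "rec_nat m (\<lambda>i v. v - 1) n = m - n" for m n :: nat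
    by (induction n) auto
  ultimately show ?thesis by simp
qed

lemma decidable_subst:
  "decidable P \<Longrightarrow> (\<And>i. computable (h i)) \<Longrightarrow> decidable (\<lambda>e. P (\<lambda>i. h i e))"
  unfolding decidable_def by (rule computable_subst[of "\<lambda>e. of_bool (P e)"])

lemma decidable_const: "decidable (\<lambda>e. P)"
  unfolding decidable_def by (rule computable_const)

lemma decidable_not:
  assumes "decidable P" shows "decidable (\<lambda>e. \<not> P e)"
  using computable_if[OF assms computable_const computable_const, of 0 1]
  unfolding decidable_def by (rule back_subst[of computable]) auto

lemma decidable_conj:
  assumes "decidable P" "decidable Q" shows "decidable (\<lambda>e. P e \<and> Q e)"
  using computable_if[OF assms(1) computable_of_bool[OF assms(2)] computable_const, of 0]
  unfolding decidable_def by (rule back_subst[of computable]) auto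

lemma decidable_disj:
  assumes "decidable P" "decidable Q" shows "decidable (\<lambda>e. P e \<or> Q e)"
  using decidable_not[OF decidable_conj[OF decidable_not[OF assms(1)] decidable_not[OF assms(2)]]]
  by (simp only: de_Morgan_conj not_not)

lemma decidable_imp:
  assumes "decidable P" "decidable Q" shows "decidable (\<lambda>e. P e \<longrightarrow> Q e)"
  using decidable_disj[OF decidable_not[OF assms(1)] assms(2)]
  by (simp only: imp_conv_disj)

lemma decidable_eq0:
  assumes "computable a" shows "decidable (\<lambda>e. a e = 0)"
  using computable_diff[OF computable_const[of 1] assms]
  unfolding decidable_def by (rule back_subst[of computable]) (auto simp: of_bool_def)

lemma decidable_le:
  assumes "computable a" "computable b" shows "decidable (\<lambda>e. a e \<le> b e)"
  using decidable_eq0[OF computable_diff[OF assms]] by (simp only: diff_is_0_eq)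

lemma decidable_less:
  assumes "computable a" "computable b" shows "decidable (\<lambda>e. a e < b e)"
  using decidable_not[OF decidable_le[OF assms(2,1)]] by (simp only: not_le)

lemma decidable_eq:
  assumes "computable a" "computable b" shows "decidable (\<lambda>e. a e = b e)"
  using decidable_conj[OF decidable_le[OF assms] decidable_le[OF assms(2,1)]]
  by (simp only: order.eq_iff[symmetric])

text \<open>Deletes variable 1 of the environment. In the step of a recursion, \<open>e 1\<close> is
  the accumulated value, which a predicate of the counter and the outer variables must not
  see.\<close>

lemma computable_shift: "computable (\<lambda>e. if i = 0 then e 0 else e (Suc i))"
  by (cases "i = 0") (simp_all add: computable_var)

lemma decidable_all_less:
  assumes "computable b" "decidable (\<lambda>e. P (e 0) (\<lambda>i. e (Suc i)))"
  shows "decidable (\<lambda>e. \<forall>n<b e. P n e)"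
proof -
  have "computable (\<lambda>e. of_bool (P (e 0) (\<lambda>i. e (Suc (Suc i)))))"
    using decidable_subst[OF assms(2), of "\<lambda>i e. if i = 0 then e 0 else e (Suc i)"]
    by (intro computable_of_bool) (simp add: computable_shift)
  then have "computable (\<lambda>e. rec_nat 1 (\<lambda>i v. of_bool (P i e) * v) (b e))"
    by (intro computable_rec_nat computable_const assms(1) computable_mult computable_var)
  moreover have "rec_nat 1 (\<lambda>i v. of_bool (Q i) * v) n = (of_bool (\<forall>i<n. Q i) :: nat)" for Q and n :: nat
    by (induction n) (auto simp: less_Suc_eq)
  ultimately show ?thesis unfolding decidable_def by simp
qed

lemma decidable_ex_less:
  assumes "computable b" "decidable (\<lambda>e. P (e 0) (\<lambda>i. e (Suc i)))"
  shows "decidable (\<lambda>e. \<exists>n<b e. P n e)"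
  using decidable_not[OF decidable_all_less[where P = "\<lambda>n e. \<not> P n e", OF assms(1) decidable_not[OF assms(2)]]]
  by (simp only: not_all not_imp not_not)

lemma decidable_dvd:
  assumes "computable a" "computable b"
  shows "decidable (\<lambda>e. a e dvd b e)"
proof -
  have "decidable (\<lambda>e. \<exists>c<Suc (b e). b e = a e * c)"
    by (intro decidable_ex_less computable_Suc decidable_eq computable_mult computable_var
        computable_weaken[OF assms(1)] computable_weaken[OF assms(2)] assms(2))
  moreover have "m dvd n \<longleftrightarrow> (\<exists>c<Suc n. n = m * c)" for m n :: nat
  proof
    assume "m dvd n"
    then obtain c where "n = m * c" by (elim dvdE)
    then show "\<exists>c<Suc n. n = m * c"
      by (cases "m = 0") (auto intro!: exI[of _ c] simp: less_Suc_eq_le)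
  qed auto
  ultimately show ?thesis by simp
qed

lemmas computable_intros = computable_var computable_const computable_Suc computable_add
  computable_mult computable_diff computable_power computable_if
  decidable_const decidable_not decidable_conj decidable_disj decidable_imp decidable_le
  decidable_less decidable_eq decidable_all_less decidable_ex_less decidable_dvd

text \<open>The arity obtained from \<open>computable\<close> may exceed k. The function depends on
  the first k values only, so the surplus arguments are set to 0, and
  \<open>recursive_fun.ext\<close> asks for agreement only on lists of length k.\<close>

lemma recursive_funI: "computable (\<lambda>e. f (map e [0..<k])) \<Longrightarrow> recursive_fun k f"
proof -
  assume "computable (\<lambda>e. f (map e [0..<k]))"
  then obtain K where "\<And>l. l \<ge> K \<Longrightarrow> \<exists>g. recursive_fun l g \<and> (\<forall>e. f (map e [0..<k]) = g (map e [0..<l]))"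
    unfolding computable_iff_eventually by blast
  from this[of "K + k"] obtain g where g: "recursive_fun (K + k) g"
    "\<And>e. f (map e [0..<k]) = g (map e [0..<K + k])" by auto
  have "recursive_fun k (\<lambda>xs. g (map (\<lambda>i. if i < k then xs ! i else 0) [0..<K+k]))"
  proof (intro recursive_fun.comp[OF g(1)])
    fix i show "recursive_fun k (\<lambda>xs. if i < k then xs ! i else 0)"
      by (cases "i < k") (auto intro: recursive_fun.proj recursive_fun.const)
  qed
  then show ?thesis
  proof (rule recursive_fun.ext)
    fix xs :: "nat list" assume "length xs = k"
    then have "map (\<lambda>i. if i < k then xs ! i else 0) [0..<k] = xs"
      by (intro nth_equalityI) auto
    then show "g (map (\<lambda>i. if i < k then xs ! i else 0) [0..<K+k]) = f xs"
      using g(2)[of "\<lambda>i. if i < k then xs ! i else 0"] by simp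
  qed
qed

lemma recursive_seq_iff: "recursive_seq a \<longleftrightarrow> computable (\<lambda>e. a (e 0))"
proof
  assume "recursive_seq a"
  then show "computable (\<lambda>e. a (e 0))"
    unfolding recursive_seq_def by (auto dest: computable_recursive_fun)
next
  assume "computable (\<lambda>e. a (e 0))"
  then show "recursive_seq a"
    unfolding recursive_seq_def by (intro recursive_funI) auto
qed

lemma computable_recursive_seq: "recursive_seq a \<Longrightarrow> computable f \<Longrightarrow> computable (\<lambda>e. a (f e))"
  unfolding recursive_seq_iff by (rule computable_apply1)

lemma recursive_relI: "decidable (\<lambda>e. R (map e [0..<k])) \<Longrightarrow> recursive_rel k R"
  unfolding recursive_rel_def decidable_def of_bool_def by (rule recursive_funI)

lemma decidable_recursive_rel: "recursive_rel k R \<Longrightarrow> decidable (\<lambda>e. R (map e [0..<k]))"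
  unfolding recursive_rel_def decidable_def of_bool_def by (rule computable_recursive_fun)

section \<open>Tuple codes\<close>

abbreviation nth_prime :: "nat \<Rightarrow> nat" where
  "nth_prime \<equiv> enumerate {p. prime p}"

lemma infinite_primes: "infinite {p :: nat. prime p}"
  by (rule primes_infinite)

lemma prime_nth_prime: "prime (nth_prime i)"
  using enumerate_in_set[OF infinite_primes] by simp

lemma nth_prime_gt_1: "Suc 0 < nth_prime i"
  using prime_gt_Suc_0_nat[OF prime_nth_prime] .

lemma nth_prime_neq_0: "nth_prime i \<noteq> 0"
  using nth_prime_gt_1[of i] by simp

lemma nth_prime_less_iff: "nth_prime i < nth_prime j \<longleftrightarrow> i < j"
  using infinite_primes by (rule enumerate_mono_iff)

lemma nth_prime_eq_iff: "nth_prime i = nth_prime j \<longleftrightarrow> i = j"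
  by (metis nth_prime_less_iff nat_neq_iff)

lemma prime_nat_obtain_index:
  assumes "prime (p :: nat)"
  obtains i where "p = nth_prime i"
  using enumerate_Ex[of "{p. prime p}" p] infinite_primes assms by auto

lemma decidable_prime: "computable f \<Longrightarrow> decidable (\<lambda>e. prime (f e))"
proof -
  have "decidable (\<lambda>e. 1 < e 0 \<and> (\<forall>m<Suc (e 0). m dvd e 0 \<longrightarrow> m = 1 \<or> m = e 0))"
    by (intro computable_intros)
  moreover have "prime n \<longleftrightarrow> 1 < n \<and> (\<forall>m<Suc n. m dvd n \<longrightarrow> m = 1 \<or> m = n)" for n :: nat
    unfolding prime_nat_iff using dvd_imp_le[of _ n] by (auto simp: less_Suc_eq_le)
  ultimately have "decidable (\<lambda>e. prime (e 0))" by simp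
  then show "computable f \<Longrightarrow> decidable (\<lambda>e. prime (f e))"
    unfolding decidable_def by (rule computable_apply1)
qed

lemma computable_nth_prime:
  assumes "computable f"
  shows "computable (\<lambda>e. nth_prime (f e))"
proof -
  have "computable (\<lambda>e. LEAST s. prime s \<and> e 0 < s)"
    by (intro computable_Least decidable_conj decidable_prime decidable_less computable_var)
      (metis bigger_prime)
  from computable_apply1[OF this computable_var[of 1]]
  have "computable (\<lambda>e. rec_nat (nth_prime 0) (\<lambda>_ v. LEAST s. prime s \<and> v < s) (f e))"
    by (intro computable_rec_nat assms computable_const)
  moreover have "rec_nat (nth_prime 0) (\<lambda>_ v. LEAST s. prime s \<and> v < s) n = nth_prime n" for n
    by (induction n) (simp_all add: enumerate_Suc'' infinite_primes)
  ultimately show ?thesis by simp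
qed

lemma tuple_code_pos: "0 < tuple_code ts"
  unfolding tuple_code_def
  by (intro prod_pos ballI zero_less_power Suc_lessD[OF nth_prime_gt_1])

lemma multiplicity_tuple_code:
  "multiplicity (nth_prime j) (tuple_code ts) = (if j < length ts then ts ! j + 1 else 0)"
proof -
  have "multiplicity (nth_prime j) (tuple_code ts) =
      (\<Sum>i<length ts. multiplicity (nth_prime j) (nth_prime i ^ (ts ! i + 1)))"
    unfolding tuple_code_def
    using prime_nth_prime by (subst prime_elem_multiplicity_prod_distrib)
      (auto simp: prime_imp_prime_elem nth_prime_neq_0)
  also have "\<dots> = (\<Sum>i<length ts. if i = j then ts ! i + 1 else 0)"
    using prime_nth_prime
    by (intro sum.cong refl) (auto simp: multiplicity_distinct_prime_power nth_prime_eq_iff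
        prime_imp_prime_elem prime_elem_multiplicity_power_distrib simp del: power_Suc)
  also have "\<dots> = (if j < length ts then ts ! j + 1 else 0)"
    by (simp add: sum.delta)
  finally show ?thesis .
qed

text \<open>Unique factorization turns decoding into divisibility by prime powers, which is
  decidable.\<close>

lemma nth_prime_power_dvd_tuple_code:
  "nth_prime j ^ Suc k dvd tuple_code ts \<longleftrightarrow> j < length ts \<and> k \<le> ts ! j"
  using tuple_code_pos[of ts] prime_nth_prime[of j]
  by (subst power_dvd_iff_le_multiplicity) (auto simp: multiplicity_tuple_code prime_imp_prime_elem)

lemma tuple_code_inject: "tuple_code ts = tuple_code ts' \<longleftrightarrow> ts = ts'"
proof
  assume eq: "tuple_code ts = tuple_code ts'"
  have *: "(j < length ts \<longleftrightarrow> j < length ts') \<and> (j < length ts \<longrightarrow> ts ! j = ts' ! j)" for j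
    using multiplicity_tuple_code[of j ts] multiplicity_tuple_code[of j ts'] eq
    by (simp split: if_splits)
  then have "length ts = length ts'" by (meson nat_neq_iff)
  with * show "ts = ts'" by (auto intro: nth_equalityI)
qed simp

lemma nth_code_tuple_code: "nth_code (tuple_code ts) i = (if i < length ts then ts ! i else 0)"
  unfolding nth_code_def by (auto simp: tuple_code_inject)

lemma nth_code_not_code: "u \<notin> range tuple_code \<Longrightarrow> nth_code u i = 0"
  unfolding nth_code_def by auto

lemma nth_code_0 [simp]: "nth_code 0 i = 0"
  by (rule nth_code_not_code) (metis imageE less_irrefl tuple_code_pos)

text \<open>If u codes a tuple longer than i, then the i-th prime divides u, and this prime is at
  least i. The bound makes equality of \<open>nth_code a\<close> and \<open>nth_code b\<close> a
  question about finitely many places.\<close>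

lemma nth_code_eq_0: "u < i \<Longrightarrow> nth_code u i = 0"
proof (cases "u \<in> range tuple_code")
  case True
  then obtain ts where u: "u = tuple_code ts" by auto
  assume i: "u < i"
  have "\<not> i < length ts"
  proof
    assume "i < length ts"
    then have "nth_prime i dvd u"
      using nth_prime_power_dvd_tuple_code[of i 0 ts] u by simp
    then have "nth_prime i \<le> u"
      using tuple_code_pos u by (intro dvd_imp_le) auto
    then show False
      using le_enumerate[OF infinite_primes, of i] i by simp
  qed
  then show ?thesis using u by (simp add: nth_code_tuple_code)
qed (simp add: nth_code_not_code)

text \<open>Each entry contributes an exponent of at least one, so codes are the positive numbers
  whose prime divisors form an initial segment of the primes. With the quantifiers bounded this is
  decidable, which is needed because \<open>nth_code\<close> is 0 on all other numbers.\<close>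

lemma range_tuple_code:
  "u \<in> range tuple_code \<longleftrightarrow>
     0 < u \<and> (\<forall>p<Suc u. \<forall>q<p. prime p \<and> p dvd u \<and> prime q \<longrightarrow> q dvd u)" (is "_ \<longleftrightarrow> ?R")
proof
  assume "u \<in> range tuple_code"
  then obtain ts where u: "u = tuple_code ts" by auto
  have "q dvd u" if "prime p" "p dvd u" "prime q" "q < p" for p q
  proof -
    obtain i where i: "p = nth_prime i" using \<open>prime p\<close> by (rule prime_nat_obtain_index)
    obtain j where j: "q = nth_prime j" using \<open>prime q\<close> by (rule prime_nat_obtain_index)
    from i j show ?thesis
      using that nth_prime_power_dvd_tuple_code[of i 0 ts] nth_prime_power_dvd_tuple_code[of j 0 ts]
      by (simp add: u nth_prime_less_iff)
  qed
  then show ?R using tuple_code_pos u by auto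
next
  assume R: ?R
  then have u: "u > 0" and down: "\<And>p q. prime p \<Longrightarrow> p dvd u \<Longrightarrow> prime q \<Longrightarrow> q < p \<Longrightarrow> q dvd u"
    by (auto dest: dvd_imp_le simp: less_Suc_eq_le)
  \<comment> \<open>The index of the first prime not dividing u will be the length of the
    tuple.\<close>
  define n where "n = (LEAST n. \<not> nth_prime n dvd u)"
  have "\<not> nth_prime (Suc u) dvd u"
    using le_enumerate[OF infinite_primes, of "Suc u"] u by (auto dest: dvd_imp_le)
  then have n: "\<not> nth_prime n dvd u" "\<And>i. i < n \<Longrightarrow> nth_prime i dvd u"
    unfolding n_def by (rule LeastI, use not_less_Least in blast)
  have "prime_factors u = nth_prime ` {..<n}"
  proof (intro equalityI subsetI)
    fix p assume "p \<in> prime_factors u"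
    then have p: "prime p" "p dvd u" by auto
    obtain i where i: "p = nth_prime i" using p(1) by (rule prime_nat_obtain_index)
    have "\<not> n < i"
      using down[OF p prime_nth_prime[of n]] n(1) by (auto simp: i nth_prime_less_iff)
    then have "i < n" using n(1) p(2) i by (cases "i = n") auto
    then show "p \<in> nth_prime ` {..<n}" using i by blast
  next
    fix p assume "p \<in> nth_prime ` {..<n}"
    then show "p \<in> prime_factors u"
      using n u prime_nth_prime by (auto simp: prime_factors_dvd)
  qed
  moreover have "u = (\<Prod>p\<in>prime_factors u. p ^ multiplicity p u)"
    using prime_factorization_nat u by blast
  ultimately have "u = (\<Prod>p\<in>nth_prime ` {..<n}. p ^ multiplicity p u)" by simp
  also have "\<dots> = (\<Prod>i<n. nth_prime i ^ multiplicity (nth_prime i) u)"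
    by (subst prod.reindex) (auto simp: inj_on_def nth_prime_eq_iff)
  also have "\<dots> = tuple_code (map (\<lambda>i. multiplicity (nth_prime i) u - 1) [0..<n])"
  proof -
    have "multiplicity (nth_prime i) u - 1 + 1 = multiplicity (nth_prime i) u" if "i < n" for i
      using n(2)[OF that] u prime_nth_prime[of i]
      by (simp add: prime_multiplicity_gt_zero_iff prime_imp_prime_elem)
    then show ?thesis unfolding tuple_code_def by (intro prod.cong) auto
  qed
  finally show "u \<in> range tuple_code" by blast
qed

text \<open>An entry t gives the exponent t + 1, so t is the least k such that the power k + 2 of
  the prime fails to divide u. Non-codes and positions beyond the length stop at k = 0, the default
  value. The definite description thus becomes a search.\<close>

lemma nth_code_Least:
  "nth_code u i = (LEAST k. \<not> (u \<in> range tuple_code \<and> nth_prime i ^ Suc (Suc k) dvd u))"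
proof (cases "u \<in> range tuple_code")
  case True
  then obtain ts where u: "u = tuple_code ts" by auto
  show ?thesis
    using True
    by (subst nth_prime_power_dvd_tuple_code[of i _ ts, folded u])
       (auto simp: u nth_code_tuple_code intro!: Least_equality[symmetric])
qed (simp add: nth_code_not_code)

lemma computable_nth_code:
  assumes "computable f" "computable g"
  shows "computable (\<lambda>e. nth_code (f e) (g e))"
proof -
  have dec: "decidable (\<lambda>e. 0 < e 0 \<and> (\<forall>p<Suc (e 0). \<forall>q<p. prime p \<and> p dvd e 0 \<and> prime q \<longrightarrow> q dvd e 0))"
    by (intro computable_intros decidable_prime)
  have "\<exists>k. \<not> (u \<in> range tuple_code \<and> nth_prime i ^ Suc (Suc k) dvd u)" for u i
  proof (intro exI[of _ u] notI; elim conjE)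
    assume "u \<in> range tuple_code" "nth_prime i ^ Suc (Suc u) dvd u"
    then have "nth_prime i ^ Suc (Suc u) \<le> u"
      using tuple_code_pos by (intro dvd_imp_le) auto
    moreover have "Suc (Suc u) < nth_prime i ^ Suc (Suc u)"
      using nth_prime_gt_1 by (intro power_gt_expt) auto
    ultimately show False by simp
  qed
  then have "computable (\<lambda>e. LEAST k. \<not> (e 0 \<in> range tuple_code \<and> nth_prime (e 1) ^ Suc (Suc k) dvd e 0))"
    by (intro computable_Least)
      (use decidable_subst[OF dec, of "\<lambda>i e. e (Suc i)"] in
        \<open>intro decidable_not decidable_conj computable_intros computable_nth_prime;
         simp add: range_tuple_code computable_var\<close>)+
  then have "computable (\<lambda>e. nth_code (e 0) (e 1))"
    unfolding nth_code_Least .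
  then show ?thesis using assms by (rule computable_apply2)
qed

text \<open>Triples are the format of neighbourhood codes: centre, numerator, denominator minus one.
  With last entry 0 they also serve as pairs.\<close>

lemma tuple_code_3: "tuple_code [a, b, c] =
    nth_prime 0 ^ Suc a * nth_prime 1 ^ Suc b * nth_prime 2 ^ Suc c"
  by (simp add: tuple_code_def lessThan_Suc eval_nat_numeral mult_ac)

lemma nth_code_3 [simp]:
  "nth_code (tuple_code [a, b, c]) 0 = a"
  "nth_code (tuple_code [a, b, c]) (Suc 0) = b"
  "nth_code (tuple_code [a, b, c]) 2 = c"
  by (simp_all add: nth_code_tuple_code)

lemma computable_tuple_code_3:
  "computable f \<Longrightarrow> computable g \<Longrightarrow> computable h \<Longrightarrow> computable (\<lambda>e. tuple_code [f e, g e, h e])"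
  unfolding tuple_code_3 by (intro computable_intros computable_nth_prime)

section \<open>Semirecursive relations with an oracle\<close>

text \<open>A number \<open>s\<close> codes the finite sequence \<open>(s)\<^sub>1, \<dots>, (s)\<^sub>n\<close> where \<open>n = (s)\<^sub>0\<close>, and \<open>agrees s \<alpha>\<close> says that it is
  an initial segment of \<open>\<alpha>\<close>.\<close>

definition agrees :: "nat \<Rightarrow> (nat \<Rightarrow> nat) \<Rightarrow> bool" where
  "agrees s \<alpha> \<longleftrightarrow> (\<forall>i<nth_code s 0. \<alpha> i = nth_code s (Suc i))"

definition extends :: "nat \<Rightarrow> nat \<Rightarrow> bool" where
  "extends t s \<longleftrightarrow> nth_code t 0 \<le> nth_code s 0 \<and>
     (\<forall>i<nth_code t 0. nth_code s (Suc i) = nth_code t (Suc i))"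

text \<open>A normal form for relations semirecursive in an oracle: an accepting computation has
  read only a finite segment s of \<alpha>, and w is its unbounded witness. The matrix
  \<open>Q\<close> does not see \<alpha>.\<close>

definition semirec :: "((nat \<Rightarrow> nat) \<Rightarrow> (nat \<Rightarrow> nat) \<Rightarrow> bool) \<Rightarrow> bool" where
  "semirec R \<longleftrightarrow> (\<exists>Q. decidable Q \<and>
     (\<forall>\<alpha> e. R \<alpha> e \<longleftrightarrow> (\<exists>s w. agrees s \<alpha> \<and> Q (case_nat s (case_nat w e)))))"

lemma ex_nth_code: "\<exists>s. \<forall>i<n. nth_code s i = f i"
  by (rule exI[of _ "tuple_code (map f [0..<n])"]) (simp add: nth_code_tuple_code)

lemma ex_agrees: "\<exists>s. agrees s \<alpha> \<and> nth_code s 0 = n"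
proof -
  obtain s where s: "\<And>i. i < Suc n \<Longrightarrow> nth_code s i = (case i of 0 \<Rightarrow> n | Suc j \<Rightarrow> \<alpha> j)"
    using ex_nth_code[of "Suc n" "case_nat n \<alpha>"] by blast
  have "nth_code s 0 = n" using s[of 0] by simp
  moreover have "nth_code s (Suc i) = \<alpha> i" if "i < n" for i using s[of "Suc i"] that by simp
  ultimately show ?thesis unfolding agrees_def by (intro exI[of _ s]) simp
qed

lemma agrees_extends: "agrees s \<alpha> \<Longrightarrow> extends t s \<Longrightarrow> agrees t \<alpha>"
  unfolding agrees_def extends_def by auto

lemma extends_if_agrees:
  "agrees s \<alpha> \<Longrightarrow> agrees t \<alpha> \<Longrightarrow> nth_code t 0 \<le> nth_code s 0 \<Longrightarrow> extends t s"
  unfolding agrees_def extends_def by auto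

lemma computable_env: "computable f \<Longrightarrow> (\<And>i. computable (\<lambda>e. H e i)) \<Longrightarrow> computable (\<lambda>e. f (H e))"
  using computable_subst[of f "\<lambda>i e. H e i"] by simp

lemma decidable_env: "decidable P \<Longrightarrow> (\<And>i. computable (\<lambda>e. H e i)) \<Longrightarrow> decidable (\<lambda>e. P (H e))"
  using decidable_subst[of P "\<lambda>i e. H e i"] by simp

lemma computable_case_nat:
  "computable a \<Longrightarrow> (\<And>i. computable (\<lambda>e. H e i)) \<Longrightarrow> computable (\<lambda>e. case_nat (a e) (H e) i)"
  by (cases i) simp_all

lemma decidable_extends:
  assumes "computable f" "computable g" shows "decidable (\<lambda>e. extends (f e) (g e))"
  unfolding extends_def
  by (intro computable_intros computable_nth_code assms computable_weaken[OF assms(1)]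
     computable_weaken[OF assms(2)])

lemma semirecI:
  assumes "decidable (\<lambda>e. Q (e 0) (e 1) (\<lambda>i. e (Suc (Suc i))))"
    "\<And>\<alpha> e. R \<alpha> e \<longleftrightarrow> (\<exists>s w. agrees s \<alpha> \<and> Q s w e)"
  shows "semirec R"
  unfolding semirec_def using assms
  by (intro exI[of _ "\<lambda>e. Q (e 0) (e 1) (\<lambda>i. e (Suc (Suc i)))"]) simp

text \<open>The matrix comes with its closure under substitution of computable terms, so
  decidability of the matrices built from it follows by plain \<open>intro\<close>.\<close>

lemma semirecE:
  assumes "semirec R"
  obtains Q where "\<And>a b H. computable a \<Longrightarrow> computable b \<Longrightarrow> (\<And>i. computable (\<lambda>e. H e i)) \<Longrightarrow>
      decidable (\<lambda>e. Q (a e) (b e) (H e))"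
    "\<And>\<alpha> e. R \<alpha> e \<longleftrightarrow> (\<exists>s w. agrees s \<alpha> \<and> Q s w e)"
proof -
  obtain Q where Q: "decidable Q"
    "\<And>\<alpha> e. R \<alpha> e \<longleftrightarrow> (\<exists>s w. agrees s \<alpha> \<and> Q (case_nat s (case_nat w e)))"
    using assms unfolding semirec_def by blast
  show thesis
  proof (rule that[of "\<lambda>s w e. Q (case_nat s (case_nat w e))"])
    fix a b and H :: "(nat \<Rightarrow> nat) \<Rightarrow> nat \<Rightarrow> nat"
    assume a: "computable a" "computable b" "\<And>i. computable (\<lambda>e. H e i)"
    show "decidable (\<lambda>e. Q (case_nat (a e) (case_nat (b e) (H e))))"
      by (intro decidable_env[OF Q(1)] computable_case_nat a)
  qed (rule Q(2))
qed

lemma semirec_env: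
  assumes "semirec R" "\<And>i. computable (\<lambda>e. H e i)"
  shows "semirec (\<lambda>\<alpha> e. R \<alpha> (H e))"
proof -
  obtain Q where Q: "\<And>a b H. computable a \<Longrightarrow> computable b \<Longrightarrow> (\<And>i. computable (\<lambda>e. H e i)) \<Longrightarrow>
      decidable (\<lambda>e. Q (a e) (b e) (H e))"
    "\<And>\<alpha> e. R \<alpha> e \<longleftrightarrow> (\<exists>s w. agrees s \<alpha> \<and> Q s w e)"
    using semirecE[OF assms(1)] by blast
  have "computable (\<lambda>e. H (\<lambda>i. e (Suc (Suc i))) j)" for j
    using computable_weaken[OF computable_weaken[OF assms(2)[of j]]] by simp
  then show ?thesis
    using Q(2) by (intro semirecI[where Q = "\<lambda>s w e. Q s w (H e)"] Q(1) computable_var) auto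
qed

lemma semirec_weaken: "semirec R \<Longrightarrow> semirec (\<lambda>\<alpha> e. R \<alpha> (\<lambda>i. e (Suc i)))"
  by (erule semirec_env[where H = "\<lambda>e i. e (Suc i)"]) (rule computable_var)

lemma semirec_decidable:
  assumes "decidable P" shows "semirec (\<lambda>\<alpha> e. P e)"
proof (rule semirecI)
  show "decidable (\<lambda>e. P (\<lambda>i. e (Suc (Suc i))))"
    by (intro decidable_env[OF assms] computable_var)
  show "P e \<longleftrightarrow> (\<exists>s w. agrees s \<alpha> \<and> P e)" for \<alpha> e
    using ex_agrees by auto
qed

lemma semirec_oracle:
  assumes "computable f" "computable g"
  shows "semirec (\<lambda>\<alpha> e. \<alpha> (f e) = g e)"
proof (rule semirecI)
  \<comment> \<open>The length test matters: \<open>agrees\<close> says nothing about the entries of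
    s beyond its length.\<close>
  show "decidable (\<lambda>e. f (\<lambda>i. e (Suc (Suc i))) < nth_code (e 0) 0 \<and>
      nth_code (e 0) (Suc (f (\<lambda>i. e (Suc (Suc i))))) = g (\<lambda>i. e (Suc (Suc i))))"
    by (intro computable_intros computable_nth_code computable_weaken[OF computable_weaken[OF assms(1)]]
     computable_weaken[OF computable_weaken[OF assms(2)]])
  show "\<alpha> (f e) = g e \<longleftrightarrow> (\<exists>s w. agrees s \<alpha> \<and> f e < nth_code s 0 \<and> nth_code s (Suc (f e)) = g e)"
    for \<alpha> e
    using ex_agrees[of \<alpha> "Suc (f e)"] by (auto simp: agrees_def)
qed

lemma semirec_disj:
  assumes "semirec R" "semirec R'"
  shows "semirec (\<lambda>\<alpha> e. R \<alpha> e \<or> R' \<alpha> e)"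
proof -
  obtain Q where Q: "\<And>a b H. computable a \<Longrightarrow> computable b \<Longrightarrow> (\<And>i. computable (\<lambda>e. H e i)) \<Longrightarrow>
      decidable (\<lambda>e. Q (a e) (b e) (H e))"
    "\<And>\<alpha> e. R \<alpha> e \<longleftrightarrow> (\<exists>s w. agrees s \<alpha> \<and> Q s w e)"
    using semirecE[OF assms(1)] by blast
  obtain Q' where Q': "\<And>a b H. computable a \<Longrightarrow> computable b \<Longrightarrow> (\<And>i. computable (\<lambda>e. H e i)) \<Longrightarrow>
      decidable (\<lambda>e. Q' (a e) (b e) (H e))"
    "\<And>\<alpha> e. R' \<alpha> e \<longleftrightarrow> (\<exists>s w. agrees s \<alpha> \<and> Q' s w e)"
    using semirecE[OF assms(2)] by blast
  show ?thesis
    by (rule semirecI[where Q = "\<lambda>s w e. Q s w e \<or> Q' s w e"])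
      (intro decidable_disj Q(1) Q'(1) computable_var, auto simp: Q(2) Q'(2))
qed

lemma semirec_conj_decidable:
  assumes "semirec R" "decidable P"
  shows "semirec (\<lambda>\<alpha> e. P e \<and> R \<alpha> e)"
proof -
  obtain Q where Q: "\<And>a b H. computable a \<Longrightarrow> computable b \<Longrightarrow> (\<And>i. computable (\<lambda>e. H e i)) \<Longrightarrow>
      decidable (\<lambda>e. Q (a e) (b e) (H e))"
    "\<And>\<alpha> e. R \<alpha> e \<longleftrightarrow> (\<exists>s w. agrees s \<alpha> \<and> Q s w e)"
    using semirecE[OF assms(1)] by blast
  show ?thesis
    by (rule semirecI[where Q = "\<lambda>s w e. P e \<and> Q s w e"])
      (intro decidable_conj decidable_env[OF assms(2)] Q(1) computable_var, auto simp: Q(2))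
qed

lemma semirec_ex:
  assumes "semirec (\<lambda>\<alpha> e. R \<alpha> (e 0) (\<lambda>i. e (Suc i)))"
  shows "semirec (\<lambda>\<alpha> e. \<exists>n. R \<alpha> n e)"
proof -
  obtain Q where Q: "\<And>a b H. computable a \<Longrightarrow> computable b \<Longrightarrow> (\<And>i. computable (\<lambda>e. H e i)) \<Longrightarrow>
      decidable (\<lambda>e. Q (a e) (b e) (H e))"
    "\<And>\<alpha> e. R \<alpha> (e 0) (\<lambda>i. e (Suc i)) \<longleftrightarrow> (\<exists>s w. agrees s \<alpha> \<and> Q s w e)"
    using semirecE[OF assms(1)] by blast
  have R: "R \<alpha> n e \<longleftrightarrow> (\<exists>s w. agrees s \<alpha> \<and> Q s w (case_nat n e))" for \<alpha> n e
    using Q(2)[of \<alpha> "case_nat n e"] by simp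
  show ?thesis
  \<comment> \<open>The new witness packs n together with the old witness.\<close>
  proof (rule semirecI[where Q = "\<lambda>s w e. Q s (nth_code w 1) (case_nat (nth_code w 0) e)"])
    show "decidable (\<lambda>e. Q (e 0) (nth_code (e 1) 1)
        (case_nat (nth_code (e 1) 0) (\<lambda>i. e (Suc (Suc i)))))"
      by (intro Q(1) computable_case_nat computable_nth_code computable_var computable_const)
    fix \<alpha> e
    have "\<exists>w'. nth_code w' 1 = w \<and> nth_code w' 0 = n" for w n
      by (rule exI[of _ "tuple_code [n, w, 0]"]) simp
    then show "(\<exists>n. R \<alpha> n e) \<longleftrightarrow>
        (\<exists>s w. agrees s \<alpha> \<and> Q s (nth_code w 1) (case_nat (nth_code w 0) e))"
      unfolding R by metis
  qed
qed

text \<open>Finitely many computations have read segments of the same oracle, so one long segment s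
  extends them all. The witness w lists for each n its own segment and witness, and
  \<open>extends\<close> carries agreement from s back to these segments.\<close>

lemma semirec_all_less:
  assumes "computable b" "semirec (\<lambda>\<alpha> e. R \<alpha> (e 0) (\<lambda>i. e (Suc i)))"
  shows "semirec (\<lambda>\<alpha> e. \<forall>n<b e. R \<alpha> n e)"
proof -
  obtain Q where Q: "\<And>a b H. computable a \<Longrightarrow> computable b \<Longrightarrow> (\<And>i. computable (\<lambda>e. H e i)) \<Longrightarrow>
      decidable (\<lambda>e. Q (a e) (b e) (H e))"
    "\<And>\<alpha> e. R \<alpha> (e 0) (\<lambda>i. e (Suc i)) \<longleftrightarrow> (\<exists>s w. agrees s \<alpha> \<and> Q s w e)"
    using semirecE[OF assms(2)] by blast
  have R: "R \<alpha> n e \<longleftrightarrow> (\<exists>s w. agrees s \<alpha> \<and> Q s w (case_nat n e))" for \<alpha> n e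
    using Q(2)[of \<alpha> "case_nat n e"] by simp
  define Q' where "Q' s w e \<longleftrightarrow> (\<forall>n<b e. extends (nth_code (nth_code w n) 0) s \<and>
    Q (nth_code (nth_code w n) 0) (nth_code (nth_code w n) 1) (case_nat n e))" for s w e
  show ?thesis
  proof (rule semirecI[where Q = Q'])
    have b: "computable (\<lambda>e. b (\<lambda>i. e (Suc (Suc i))))"
      by (intro computable_env[OF assms(1)] computable_var)
    show "decidable (\<lambda>e. Q' (e 0) (e 1) (\<lambda>i. e (Suc (Suc i))))"
      unfolding Q'_def
      by (intro decidable_all_less b decidable_conj decidable_extends Q(1)
          computable_case_nat computable_nth_code computable_var computable_const)
    fix \<alpha> e
    show "(\<forall>n<b e. R \<alpha> n e) \<longleftrightarrow> (\<exists>s w. agrees s \<alpha> \<and> Q' s w e)"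
    proof
      assume "\<forall>n<b e. R \<alpha> n e"
      then obtain S W where SW: "\<And>n. n < b e \<Longrightarrow> agrees (S n) \<alpha> \<and> Q (S n) (W n) (case_nat n e)"
        unfolding R by metis
      obtain w where w: "\<And>n. n < b e \<Longrightarrow> nth_code w n = tuple_code [S n, W n, 0]"
        using ex_nth_code[of "b e" "\<lambda>n. tuple_code [S n, W n, 0]"] by blast
      \<comment> \<open>The sum of the lengths bounds each of them.\<close>
      obtain s where s: "agrees s \<alpha>" "nth_code s 0 = (\<Sum>n<b e. nth_code (S n) 0)"
        using ex_agrees by blast
      have "extends (S n) s" if "n < b e" for n
        using s SW[OF that] that member_le_sum[of n "{..<b e}" "\<lambda>n. nth_code (S n) 0"]
        by (intro extends_if_agrees) auto
      then have "Q' s w e"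
        unfolding Q'_def using w SW by simp
      then show "\<exists>s w. agrees s \<alpha> \<and> Q' s w e"
        using s(1) by blast
    next
      assume "\<exists>s w. agrees s \<alpha> \<and> Q' s w e"
      then show "\<forall>n<b e. R \<alpha> n e"
        unfolding R Q'_def using agrees_extends by blast
    qed
  qed
qed

text \<open>Two computations need a common segment of the oracle; the bounded quantifier, taken over
  n < 2, already provides it.\<close>

lemma semirec_conj:
  assumes "semirec R" "semirec R'"
  shows "semirec (\<lambda>\<alpha> e. R \<alpha> e \<and> R' \<alpha> e)"
proof -
  have "semirec (\<lambda>\<alpha> e. \<forall>n<2::nat. (n = 0 \<and> R \<alpha> e) \<or> (n \<noteq> 0 \<and> R' \<alpha> e))"
    using semirec_weaken[OF assms(1)] semirec_weaken[OF assms(2)]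
    by (intro semirec_all_less semirec_disj semirec_conj_decidable decidable_not decidable_eq
        computable_const computable_var)
  moreover have "(\<forall>n<2::nat. (n = 0 \<and> A) \<or> (n \<noteq> 0 \<and> B)) \<longleftrightarrow> A \<and> B" for A B
    by (auto simp: numeral_2_eq_2 less_Suc_eq)
  ultimately show ?thesis by simp
qed

text \<open>\<open>F\<close> may be the graph of a partial operator: \<open>R'\<close> is meaningful at those oracles where it is defined.\<close>

lemma semirec_subst_rel:
  assumes "semirec R" "semirec (\<lambda>\<alpha> e. F \<alpha> (e 0) (e 1) (\<lambda>i. e (Suc (Suc i))))"
  obtains R' where "semirec R'"
    "\<And>\<alpha> e f. (\<And>i m. F \<alpha> i m e \<longleftrightarrow> f i = m) \<Longrightarrow> R' \<alpha> e \<longleftrightarrow> R f e"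
proof -
  obtain Q where Q: "\<And>a b H. computable a \<Longrightarrow> computable b \<Longrightarrow> (\<And>i. computable (\<lambda>e. H e i)) \<Longrightarrow>
      decidable (\<lambda>e. Q (a e) (b e) (H e))"
    "\<And>\<alpha> e. R \<alpha> e \<longleftrightarrow> (\<exists>s w. agrees s \<alpha> \<and> Q s w e)"
    using semirecE[OF assms(1)] by blast
  show thesis
  proof (rule that)
    have "semirec (\<lambda>\<alpha> e. F \<alpha> (e 0) (nth_code (e 1) (Suc (e 0))) (\<lambda>i. e (Suc (Suc (Suc i)))))"
      using semirec_env[OF assms(2), of "\<lambda>e. case_nat (e 0) (case_nat (nth_code (e 1) (Suc (e 0)))
        (\<lambda>i. e (Suc (Suc (Suc i)))))"]
      by (simp add: computable_case_nat computable_var computable_nth_code computable_Suc)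
    \<comment> \<open>A segment s of the new oracle is guessed and its entries are checked by
      \<open>F\<close>; where \<open>F\<close> is the graph of f, the check amounts to
      \<open>agrees s f\<close>.\<close>
    then show "semirec (\<lambda>\<alpha> e. \<exists>w. \<exists>s. Q s w e \<and>
        (\<forall>i<nth_code s 0. F \<alpha> i (nth_code s (Suc i)) e))"
      by (intro semirec_ex semirec_all_less semirec_conj_decidable Q(1) computable_nth_code
          computable_var computable_const) (simp add: eval_nat_numeral)
    fix \<alpha> e f
    assume "\<And>i m. F \<alpha> i m e \<longleftrightarrow> f i = m"
    then show "(\<exists>w s. Q s w e \<and> (\<forall>i<nth_code s 0. F \<alpha> i (nth_code s (Suc i)) e)) \<longleftrightarrow> R f e"
      by (auto simp: Q(2) agrees_def)
  qed
qed

lemma semirec_subst: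
  assumes "semirec R" "semirec (\<lambda>\<alpha> e. F \<alpha> (\<lambda>i. e (Suc (Suc i))) (e 0) = e 1)"
  shows "semirec (\<lambda>\<alpha> e. R (F \<alpha> e) e)"
proof -
  obtain R' where R': "semirec R'"
    "\<And>\<alpha> e f. (\<And>i m. F \<alpha> e i = m \<longleftrightarrow> f i = m) \<Longrightarrow> R' \<alpha> e \<longleftrightarrow> R f e"
    using semirec_subst_rel[where F = "\<lambda>\<alpha> i m e. F \<alpha> e i = m", OF assms] by blast
  have "R' = (\<lambda>\<alpha> e. R (F \<alpha> e) e)"
    using R'(2) by blast
  then show ?thesis using R'(1) by simp
qed

section \<open>Recursive presentations\<close>

lemma recursive_rel_4_iff:
  "recursive_rel 4 (\<lambda>xs. P (xs ! 0) (xs ! 1) (xs ! 2) (xs ! 3)) \<longleftrightarrow>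
     decidable (\<lambda>e. P (e 0) (e 1) (e 2) (e 3))"
proof
  show "decidable (\<lambda>e. P (e 0) (e 1) (e 2) (e 3))"
    if "recursive_rel 4 (\<lambda>xs. P (xs ! 0) (xs ! 1) (xs ! 2) (xs ! 3))"
    using decidable_recursive_rel[OF that] by (simp add: numeral_2_eq_2)
  show "recursive_rel 4 (\<lambda>xs. P (xs ! 0) (xs ! 1) (xs ! 2) (xs ! 3))"
    if "decidable (\<lambda>e. P (e 0) (e 1) (e 2) (e 3))"
    using that by (intro recursive_relI) (simp add: numeral_2_eq_2)
qed

text \<open>Completeness and density are spelled out as inequalities between distances, the form in
  which they are verified for \<omega>, Baire space and products.\<close>

lemma rec_presented_iff:
  "rec_presented X \<longleftrightarrow>
     Metric_space (pts X) (metr X) \<and>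
     (\<forall>\<sigma> :: nat \<Rightarrow> _. range \<sigma> \<subseteq> pts X \<longrightarrow>
        (\<forall>\<epsilon>>0. \<exists>N. \<forall>n n'. N \<le> n \<longrightarrow> N \<le> n' \<longrightarrow> metr X (\<sigma> n) (\<sigma> n') < \<epsilon>) \<longrightarrow>
        (\<exists>l\<in>pts X. \<forall>\<epsilon>>0. \<exists>N. \<forall>n\<ge>N. metr X (\<sigma> n) l < \<epsilon>)) \<and>
     range (dseq X) \<subseteq> pts X \<and>
     (\<forall>x\<in>pts X. \<forall>r>0. \<exists>i. metr X (dseq X i) x < r) \<and>
     decidable (\<lambda>e. metr X (dseq X (e 0)) (dseq X (e 1)) \<le> real (e 2) / (real (e 3) + 1)) \<and>
     decidable (\<lambda>e. metr X (dseq X (e 0)) (dseq X (e 1)) < real (e 2) / (real (e 3) + 1))"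
proof (cases "Metric_space (pts X) (metr X) \<and> range (dseq X) \<subseteq> pts X")
  case True
  then interpret Metric_space "pts X" "metr X" by simp
  have d: "dseq X i \<in> pts X" for i using True by auto
  have "mcomplete \<longleftrightarrow> (\<forall>\<sigma> :: nat \<Rightarrow> _. range \<sigma> \<subseteq> pts X \<longrightarrow>
        (\<forall>\<epsilon>>0. \<exists>N. \<forall>n n'. N \<le> n \<longrightarrow> N \<le> n' \<longrightarrow> metr X (\<sigma> n) (\<sigma> n') < \<epsilon>) \<longrightarrow>
        (\<exists>l\<in>pts X. \<forall>\<epsilon>>0. \<exists>N. \<forall>n\<ge>N. metr X (\<sigma> n) l < \<epsilon>))"
    unfolding mcomplete_def MCauchy_def limit_metric_sequentially imp_conjL
    by (intro arg_cong[where f = All] ext) (auto simp: image_subset_iff)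
  moreover have "mtopology closure_of range (dseq X) = pts X \<longleftrightarrow>
      (\<forall>x\<in>pts X. \<forall>r>0. \<exists>i. metr X (dseq X i) x < r)"
    unfolding metric_closure_of by (auto simp: d commute)
  ultimately show ?thesis
    using True unfolding rec_presented_def
      recursive_rel_4_iff[of "\<lambda>a b m k. metr X (dseq X a) (dseq X b) \<le> real m / (real k + 1)"]
      recursive_rel_4_iff[of "\<lambda>a b m k. metr X (dseq X a) (dseq X b) < real m / (real k + 1)"]
    by simp
qed (auto simp: rec_presented_def)

lemma rec_presented_Metric_space: "rec_presented X \<Longrightarrow> Metric_space (pts X) (metr X)"
  by (simp add: rec_presented_def)

lemma dseq_in_pts: "rec_presented X \<Longrightarrow> dseq X i \<in> pts X"
  by (auto simp: rec_presented_def)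

lemma mem_nbhd_iff:
  assumes "rec_presented X"
  shows "x \<in> nbhd X s \<longleftrightarrow> x \<in> pts X \<and>
    metr X (dseq X (nth_code s 0)) x < real (nth_code s 1) / (real (nth_code s 2) + 1)"
proof -
  interpret Metric_space "pts X" "metr X" using assms by (rule rec_presented_Metric_space)
  show ?thesis unfolding nbhd_def using dseq_in_pts[OF assms] by auto
qed

lemma rec_presented_complete:
  fixes \<sigma> :: "nat \<Rightarrow> _"
  assumes "rec_presented X" "range \<sigma> \<subseteq> pts X"
    "\<And>\<epsilon>. \<epsilon> > 0 \<Longrightarrow> \<exists>N. \<forall>n n'. N \<le> n \<longrightarrow> N \<le> n' \<longrightarrow> metr X (\<sigma> n) (\<sigma> n') < \<epsilon>"
  obtains l where "l \<in> pts X" "\<And>\<epsilon>. \<epsilon> > 0 \<Longrightarrow> \<exists>N. \<forall>n\<ge>N. metr X (\<sigma> n) l < \<epsilon>"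
  using assms unfolding rec_presented_iff by blast

lemma rec_presented_dense:
  assumes "rec_presented X" "x \<in> pts X" "r > 0"
  obtains i where "metr X (dseq X i) x < r"
  using assms unfolding rec_presented_iff by blast

lemma rec_presented_decidable:
  assumes "rec_presented X"
  shows "decidable (\<lambda>e. metr X (dseq X (e 0)) (dseq X (e 1)) \<le> real (e 2) / (real (e 3) + 1))"
    "decidable (\<lambda>e. metr X (dseq X (e 0)) (dseq X (e 1)) < real (e 2) / (real (e 3) + 1))"
  using assms unfolding rec_presented_iff by blast+

subsection \<open>The natural numbers\<close>

lemma pts_omega [simp]: "pts omega = range Num"
  and dseq_omega [simp]: "dseq omega = Num"
  and metr_omega [simp]: "metr omega (Num m) (Num n) = (if m = n then 0 else 1)"
  by (simp_all add: omega_def)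

lemma le_ratio_iff: "1 \<le> real m / (real k + 1) \<longleftrightarrow> k < m"
  and less_ratio_iff: "1 < real m / (real k + 1) \<longleftrightarrow> Suc k < m"
  by (auto simp: field_simps)

text \<open>A radius above 1 gives the whole space, a radius in (0,1] a single point; m <= Suc k
  says that the radius is at most 1.\<close>

lemma omega_less_iff:
  "metr omega (Num a) (Num b) < real m / (real k + 1) \<longleftrightarrow> 0 < m \<and> (m \<le> Suc k \<longrightarrow> a = b)"
  by (auto simp: less_ratio_iff zero_less_divide_iff)

lemma rec_presented_omega: "rec_presented (omega :: 'a space)"
proof (subst rec_presented_iff, intro conjI allI impI ballI)
  show "Metric_space (pts omega) (metr (omega :: 'a space))"
    by unfold_locales (auto simp: omega_def split: if_splits point.splits)
  show "range (dseq omega) \<subseteq> pts omega" by simp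
  have "decidable (\<lambda>e. e 0 = e 1 \<or> e 3 < e 2)"
    by (intro computable_intros)
  moreover have "metr (omega :: 'a space) (Num a) (Num b) \<le> real m / (real k + 1) \<longleftrightarrow> a = b \<or> k < m" for a b m k
    by (simp add: le_ratio_iff)
  ultimately show "decidable (\<lambda>e. metr (omega :: 'a space) (dseq omega (e 0)) (dseq omega (e 1)) \<le> real (e 2) / (real (e 3) + 1))"
    unfolding dseq_omega by (simp only:)
  show "decidable (\<lambda>e. metr (omega :: 'a space) (dseq omega (e 0)) (dseq omega (e 1)) < real (e 2) / (real (e 3) + 1))"
    unfolding dseq_omega omega_less_iff by (intro computable_intros)
  show "\<exists>i. metr omega (dseq omega i) x < r" if "x \<in> pts (omega :: 'a space)" "0 < r" for x r
    using that by auto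
  fix \<sigma> :: "nat \<Rightarrow> 'a point"
  assume \<sigma>: "range \<sigma> \<subseteq> pts omega"
    "\<forall>\<epsilon>>0. \<exists>N. \<forall>n n'. N \<le> n \<longrightarrow> N \<le> n' \<longrightarrow> metr omega (\<sigma> n) (\<sigma> n') < \<epsilon>"
  from \<sigma>(1) have "\<forall>n. \<exists>m. \<sigma> n = Num m" by auto
  then obtain s where s: "\<And>n. \<sigma> n = Num (s n)" by metis
  obtain N where N: "\<And>n n'. N \<le> n \<Longrightarrow> N \<le> n' \<Longrightarrow> metr omega (\<sigma> n) (\<sigma> n') < 1"
    using \<sigma>(2) by (meson zero_less_one)
  have const: "s n = s N" if "n \<ge> N" for n
    using N[OF that order_refl] by (simp add: s split: if_splits)
  have "metr omega (\<sigma> n) (Num (s N)) < \<epsilon>" if "n \<ge> N" "\<epsilon> > 0" for n \<epsilon>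
    using const[OF that(1)] that(2) by (simp add: s)
  then show "\<exists>l\<in>pts omega. \<forall>\<epsilon>>0. \<exists>N. \<forall>n\<ge>N. metr omega (\<sigma> n) l < \<epsilon>"
    by (intro bexI[of _ "Num (s N)"]) auto
qed

subsection \<open>Baire space\<close>

lemma pts_baire [simp]: "pts baire = range Fn"
  and dseq_baire [simp]: "dseq baire = (\<lambda>i. Fn (nth_code i))"
  and metr_baire [simp]: "metr baire = baire_metric"
  by (simp_all add: baire_def)

lemma baire_metric_Fn:
  "baire_metric (Fn \<alpha>) (Fn \<beta>) = (if \<alpha> = \<beta> then 0 else 1 / (real (LEAST n. \<alpha> n \<noteq> \<beta> n) + 1))"
  by (simp add: baire_metric_def)

text \<open>If L is the first place of disagreement, the distance is 1/(L+1); it is below r iff no n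
  with 1/(n+1) >= r is a place of disagreement.\<close>

lemma baire_metric_less_iff:
  "baire_metric (Fn \<alpha>) (Fn \<beta>) < r \<longleftrightarrow> 0 < r \<and> (\<forall>n. r \<le> 1 / (real n + 1) \<longrightarrow> \<alpha> n = \<beta> n)"
proof (cases "\<alpha> = \<beta>")
  case False
  define L where "L = (LEAST n. \<alpha> n \<noteq> \<beta> n)"
  have L: "\<alpha> L \<noteq> \<beta> L"
    unfolding L_def by (rule LeastI_ex) (use False in auto)
  have L': "\<alpha> n = \<beta> n" if "n < L" for n
    using that not_less_Least unfolding L_def by blast
  have "1 / (real L + 1) < r \<longleftrightarrow> 0 < r \<and> (\<forall>n. r \<le> 1 / (real n + 1) \<longrightarrow> \<alpha> n = \<beta> n)"
  proof
    assume r: "1 / (real L + 1) < r"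
    have "0 < 1 / (real L + 1)" by simp
    then have "0 < r" using r by linarith
    moreover have "n < L" if "r \<le> 1 / (real n + 1)" for n
    proof -
      have "1 / (real L + 1) < 1 / (real n + 1)" using r that by linarith
      then show ?thesis by (simp add: field_simps)
    qed
    ultimately show "0 < r \<and> (\<forall>n. r \<le> 1 / (real n + 1) \<longrightarrow> \<alpha> n = \<beta> n)"
      using L' by auto
  next
    assume "0 < r \<and> (\<forall>n. r \<le> 1 / (real n + 1) \<longrightarrow> \<alpha> n = \<beta> n)"
    then show "1 / (real L + 1) < r" using L by (meson not_le)
  qed
  then show ?thesis using False by (simp add: baire_metric_Fn L_def)
qed (simp add: baire_metric_Fn)

lemma baire_metric_le_iff:
  "baire_metric (Fn \<alpha>) (Fn \<beta>) \<le> r \<longleftrightarrow> 0 \<le> r \<and> (\<forall>n. r < 1 / (real n + 1) \<longrightarrow> \<alpha> n = \<beta> n)"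
proof (cases "\<alpha> = \<beta>")
  case False
  define L where "L = (LEAST n. \<alpha> n \<noteq> \<beta> n)"
  have L: "\<alpha> L \<noteq> \<beta> L"
    unfolding L_def by (rule LeastI_ex) (use False in auto)
  have L': "\<alpha> n = \<beta> n" if "n < L" for n
    using that not_less_Least unfolding L_def by blast
  have "1 / (real L + 1) \<le> r \<longleftrightarrow> 0 \<le> r \<and> (\<forall>n. r < 1 / (real n + 1) \<longrightarrow> \<alpha> n = \<beta> n)"
  proof
    assume r: "1 / (real L + 1) \<le> r"
    have "0 < 1 / (real L + 1)" by simp
    then have "0 < r" using r by linarith
    moreover have "n < L" if "r < 1 / (real n + 1)" for n
    proof -
      have "1 / (real L + 1) < 1 / (real n + 1)" using r that by linarith
      then show ?thesis by (simp add: field_simps)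
    qed
    ultimately show "0 \<le> r \<and> (\<forall>n. r < 1 / (real n + 1) \<longrightarrow> \<alpha> n = \<beta> n)"
      using L' by auto
  next
    assume "0 \<le> r \<and> (\<forall>n. r < 1 / (real n + 1) \<longrightarrow> \<alpha> n = \<beta> n)"
    then show "1 / (real L + 1) \<le> r" using L by (meson not_le)
  qed
  then show ?thesis using False by (simp add: baire_metric_Fn L_def)
qed (simp add: baire_metric_Fn)

lemma baire_metric_less_imp_eq:
  "baire_metric (Fn \<alpha>) (Fn \<beta>) < 1 / (real n + 1) \<Longrightarrow> \<alpha> n = \<beta> n"
  unfolding baire_metric_less_iff by simp

lemma ratio_le_iff: "real m / (real k + 1) \<le> 1 / (real n + 1) \<longleftrightarrow> m * Suc n \<le> Suc k"
  and ratio_less_iff: "real m / (real k + 1) < 1 / (real n + 1) \<longleftrightarrow> m * Suc n < Suc k"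
proof -
  have "real m / (real k + 1) \<le> 1 / (real n + 1) \<longleftrightarrow> real m * (real n + 1) \<le> real k + 1"
    by (simp add: field_simps)
  also have "\<dots> \<longleftrightarrow> real (m * Suc n) \<le> real (Suc k)"
    by (simp add: algebra_simps)
  finally show "real m / (real k + 1) \<le> 1 / (real n + 1) \<longleftrightarrow> m * Suc n \<le> Suc k"
    by (simp only: of_nat_le_iff)
  have "real m / (real k + 1) < 1 / (real n + 1) \<longleftrightarrow> real m * (real n + 1) < real k + 1"
    by (simp add: field_simps)
  also have "\<dots> \<longleftrightarrow> real (m * Suc n) < real (Suc k)"
    by (simp add: algebra_simps)
  finally show "real m / (real k + 1) < 1 / (real n + 1) \<longleftrightarrow> m * Suc n < Suc k"
    by (simp only: of_nat_less_iff)
qed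

text \<open>For m > 0 the inequality m * Suc n <= Suc k forces n <= k, so membership in a ball
  involves a computably bounded set of places.\<close>

lemma baire_less_iff:
  "baire_metric (Fn \<alpha>) (Fn \<beta>) < real m / (real k + 1) \<longleftrightarrow>
     0 < m \<and> (\<forall>n<Suc k. m * Suc n \<le> Suc k \<longrightarrow> \<alpha> n = \<beta> n)"
proof -
  have "n < Suc k" if "0 < m" "m * Suc n \<le> Suc k" for n
  proof -
    have "1 * Suc n \<le> m * Suc n" using that(1) by (intro mult_le_mono1) simp
    also note that(2)
    finally show ?thesis by simp
  qed
  then show ?thesis
    unfolding baire_metric_less_iff ratio_le_iff by (auto simp: zero_less_divide_iff)
qed

text \<open>For m = 0 the inequality does not bound n. The two centres vanish beyond a + b, however,
  which supplies the bound.\<close>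

lemma baire_le_iff:
  "baire_metric (Fn (nth_code a)) (Fn (nth_code b)) \<le> real m / (real k + 1) \<longleftrightarrow>
     (\<forall>n<Suc (a + b + k). m * Suc n < Suc k \<longrightarrow> nth_code a n = nth_code b n)"
proof -
  have "nth_code a n = nth_code b n" if "\<not> n < Suc (a + b + k)" for n
    using that by (simp add: nth_code_eq_0)
  then show ?thesis
    unfolding baire_metric_le_iff ratio_less_iff by auto
qed

lemma rec_presented_baire: "rec_presented (baire :: 'a space)"
proof (subst rec_presented_iff, unfold pts_baire metr_baire dseq_baire, intro conjI allI impI ballI)
  have nonneg: "0 \<le> baire_metric (x :: 'a point) y" for x y
    by (auto simp: baire_metric_def split: point.splits)
  have sym: "baire_metric (x :: 'a point) y = baire_metric y x" for x y
  proof -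
    have "(LEAST n. \<alpha> n \<noteq> \<beta> n) = (LEAST n. \<beta> n \<noteq> \<alpha> n)" for \<alpha> \<beta> :: "nat \<Rightarrow> nat"
      by (rule arg_cong[where f = Least]) auto
    then show ?thesis
      unfolding baire_metric_def by (cases x; cases y) auto
  qed
  show "Metric_space (range Fn) (baire_metric :: 'a point \<Rightarrow> _)"
  proof
    show "0 \<le> baire_metric x y" for x y :: "'a point" by (rule nonneg)
    show "baire_metric x y = baire_metric y x" for x y :: "'a point" by (rule sym)
    show "baire_metric x y = 0 \<longleftrightarrow> x = y" if "x \<in> range Fn" "y \<in> range Fn" for x y :: "'a point"
      using that by (auto simp: baire_metric_Fn add_nonneg_eq_0_iff split: if_splits)
    fix x y z :: "'a point" assume "x \<in> range Fn" "y \<in> range Fn" "z \<in> range Fn"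
    then obtain a b c where xyz: "x = Fn a" "y = Fn b" "z = Fn c" by auto
    have "a n = c n" if "baire_metric x y + baire_metric y z < 1 / (real n + 1)" for n
    proof -
      have 1: "baire_metric x y < 1 / (real n + 1)" and 2: "baire_metric y z < 1 / (real n + 1)"
        using that nonneg[of x y] nonneg[of y z] by linarith+
      show ?thesis
        using baire_metric_less_imp_eq[OF 1[unfolded xyz]] baire_metric_less_imp_eq[OF 2[unfolded xyz]]
        by simp
    qed
    then have "baire_metric (Fn a) (Fn c :: 'a point) \<le> baire_metric x y + baire_metric y z"
      unfolding baire_metric_le_iff using nonneg[of x y] nonneg[of y z] by simp
    then show "baire_metric x z \<le> baire_metric x y + baire_metric y z"
      by (simp only: xyz)
  qed
  show "range (\<lambda>i. Fn (nth_code i)) \<subseteq> range Fn" by auto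
  show "decidable (\<lambda>e. baire_metric (Fn (nth_code (e 0))) (Fn (nth_code (e 1)) :: 'a point) \<le> real (e 2) / (real (e 3) + 1))"
    unfolding baire_le_iff by (intro computable_intros computable_nth_code)
  show "decidable (\<lambda>e. baire_metric (Fn (nth_code (e 0))) (Fn (nth_code (e 1)) :: 'a point) < real (e 2) / (real (e 3) + 1))"
    unfolding baire_less_iff by (intro computable_intros computable_nth_code)
  show "\<exists>i. baire_metric (Fn (nth_code i)) x < r" if xr: "x \<in> range Fn" "0 < r" for x :: "'a point" and r
  proof -
    obtain a where [simp]: "x = Fn a" using xr(1) by auto
    obtain K where K: "1 / (real K + 1) < r"
      using reals_Archimedean[OF \<open>0 < r\<close>] by (auto simp: inverse_eq_divide add.commute)
    obtain s where s: "\<And>i. i < K \<Longrightarrow> nth_code s i = a i" using ex_nth_code by blast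
    have "nth_code s n = a n" if "r \<le> 1 / (real n + 1)" for n
    proof (rule s)
      have "1 / (real K + 1) < 1 / (real n + 1)" using K that by linarith
      then show "n < K" by (simp add: field_simps)
    qed
    then show ?thesis using \<open>0 < r\<close> by (auto simp: baire_metric_less_iff)
  qed
  fix \<sigma> :: "nat \<Rightarrow> 'a point"
  assume \<sigma>: "range \<sigma> \<subseteq> range Fn"
    "\<forall>\<epsilon>>0. \<exists>N. \<forall>n n'. N \<le> n \<longrightarrow> N \<le> n' \<longrightarrow> baire_metric (\<sigma> n) (\<sigma> n') < \<epsilon>"
  from \<sigma>(1) have "\<forall>n. \<exists>m. \<sigma> n = Fn m" by auto
  then obtain s where s: "\<And>n. \<sigma> n = Fn (s n)" by metis
  have "\<exists>N. \<forall>n\<ge>N. s n i = s N i" for i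
  proof -
    obtain N where N: "\<And>n n'. N \<le> n \<Longrightarrow> N \<le> n' \<Longrightarrow> baire_metric (\<sigma> n) (\<sigma> n') < 1 / (real i + 1)"
      using \<sigma>(2)[rule_format, of "1 / (real i + 1)"] by auto
    have "s n i = s N i" if "N \<le> n" for n
      using N[OF that order_refl] unfolding s baire_metric_less_iff by simp
    then show ?thesis by blast
  qed
  then obtain N where N: "\<And>i n. n \<ge> N i \<Longrightarrow> s n i = s (N i) i" by metis
  define l where "l i = s (N i) i" for i
  have "\<exists>N. \<forall>n\<ge>N. baire_metric (\<sigma> n) (Fn l) < \<epsilon>" if "\<epsilon> > 0" for \<epsilon>
  proof -
    obtain M where M: "\<And>n n'. M \<le> n \<Longrightarrow> M \<le> n' \<Longrightarrow> baire_metric (\<sigma> n) (\<sigma> n') < \<epsilon>"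
      using \<sigma>(2) \<open>\<epsilon> > 0\<close> by meson
    have "s n i = l i" if "n \<ge> M" "\<epsilon> \<le> 1 / (real i + 1)" for n i
    proof -
      \<comment> \<open>The index is late enough both for the Cauchy estimate and for the i-th
        coordinate to have stabilized.\<close>
      have "baire_metric (\<sigma> n) (\<sigma> (max M (N i))) < \<epsilon>" using that by (intro M) auto
      then have "s n i = s (max M (N i)) i"
        unfolding s baire_metric_less_iff using that by blast
      then show ?thesis unfolding l_def using N[of i "max M (N i)"] by simp
    qed
    then show ?thesis using \<open>\<epsilon> > 0\<close> unfolding s baire_metric_less_iff by blast
  qed
  then show "\<exists>l\<in>range Fn. \<forall>\<epsilon>>0. \<exists>N. \<forall>n\<ge>N. baire_metric (\<sigma> n) l < \<epsilon>"
    by blast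
qed

subsection \<open>Products\<close>

lemma pts_prod [simp]: "pts (X \<times>\<^sub>r Y) = {Tup x y | x y. x \<in> pts X \<and> y \<in> pts Y}"
  and metr_prod [simp]: "metr (X \<times>\<^sub>r Y) (Tup x y) (Tup x' y') = max (metr X x x') (metr Y y y')"
  and dseq_prod [simp]: "dseq (X \<times>\<^sub>r Y) i = Tup (dseq X (nth_code i 0)) (dseq Y (nth_code i 1))"
  by (simp_all add: prod_space_def)

lemma decidable_nth_code_args:
  assumes "decidable (\<lambda>e. P (e 0) (e 1) (e 2) (e 3))"
  shows "decidable (\<lambda>e. P (nth_code (e 0) i) (nth_code (e 1) i) (e 2) (e 3))"
proof -
  have "computable (\<lambda>e. if j < 2 then nth_code (e j) i else e j)" for j :: nat
    by (cases "j < 2") (simp_all add: computable_var computable_nth_code computable_const)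
  from decidable_env[OF assms, of "\<lambda>e j. if j < 2 then nth_code (e j) i else e j", OF this]
  show ?thesis by simp
qed

lemma rec_presented_prod:
  assumes X: "rec_presented X" and Y: "rec_presented Y"
  shows "rec_presented (X \<times>\<^sub>r Y)"
proof (subst rec_presented_iff, intro conjI allI impI ballI)
  interpret X: Metric_space "pts X" "metr X" using X by (rule rec_presented_Metric_space)
  interpret Y: Metric_space "pts Y" "metr Y" using Y by (rule rec_presented_Metric_space)
  show "Metric_space (pts (X \<times>\<^sub>r Y)) (metr (X \<times>\<^sub>r Y))"
  proof
    show "0 \<le> metr (X \<times>\<^sub>r Y) x y" for x y
      by (auto simp: prod_space_def le_max_iff_disj split: point.splits)
    show "metr (X \<times>\<^sub>r Y) x y = metr (X \<times>\<^sub>r Y) y x" for x y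
      by (auto simp: prod_space_def X.commute Y.commute split: point.splits)
    show "metr (X \<times>\<^sub>r Y) x y = 0 \<longleftrightarrow> x = y"
      if xy: "x \<in> pts (X \<times>\<^sub>r Y)" "y \<in> pts (X \<times>\<^sub>r Y)" for x y
    proof -
      obtain a b c d where [simp]: "x = Tup a b" "y = Tup c d"
        and m: "a \<in> pts X" "b \<in> pts Y" "c \<in> pts X" "d \<in> pts Y" using xy by auto
      have "max (metr X a c) (metr Y b d) = 0 \<longleftrightarrow> metr X a c = 0 \<and> metr Y b d = 0"
        using X.nonneg[of a c] Y.nonneg[of b d] by linarith
      then show ?thesis using m by simp
    qed
    fix x y z assume "x \<in> pts (X \<times>\<^sub>r Y)" "y \<in> pts (X \<times>\<^sub>r Y)" "z \<in> pts (X \<times>\<^sub>r Y)"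
    then obtain a b c d p q where [simp]: "x = Tup a b" "y = Tup c d" "z = Tup p q"
      and m: "a \<in> pts X" "b \<in> pts Y" "c \<in> pts X" "d \<in> pts Y" "p \<in> pts X" "q \<in> pts Y" by auto
    show "metr (X \<times>\<^sub>r Y) x z \<le> metr (X \<times>\<^sub>r Y) x y + metr (X \<times>\<^sub>r Y) y z"
      using X.triangle[of a c p] Y.triangle[of b d q] m by simp linarith
  qed
  show "range (dseq (X \<times>\<^sub>r Y)) \<subseteq> pts (X \<times>\<^sub>r Y)"
    using dseq_in_pts[OF X] dseq_in_pts[OF Y] by auto
  show "decidable (\<lambda>e. metr (X \<times>\<^sub>r Y) (dseq (X \<times>\<^sub>r Y) (e 0)) (dseq (X \<times>\<^sub>r Y) (e 1)) \<le> real (e 2) / (real (e 3) + 1))"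
    unfolding dseq_prod metr_prod max.bounded_iff
    by (intro decidable_conj decidable_nth_code_args[where P = "\<lambda>a b m k. metr X (dseq X a) (dseq X b) \<le> real m / (real k + 1)"]
      decidable_nth_code_args[where P = "\<lambda>a b m k. metr Y (dseq Y a) (dseq Y b) \<le> real m / (real k + 1)"])
      (rule rec_presented_decidable[OF X] rec_presented_decidable[OF Y])+
  show "decidable (\<lambda>e. metr (X \<times>\<^sub>r Y) (dseq (X \<times>\<^sub>r Y) (e 0)) (dseq (X \<times>\<^sub>r Y) (e 1)) < real (e 2) / (real (e 3) + 1))"
    unfolding dseq_prod metr_prod max_less_iff_conj
    by (intro decidable_conj decidable_nth_code_args[where P = "\<lambda>a b m k. metr X (dseq X a) (dseq X b) < real m / (real k + 1)"]
      decidable_nth_code_args[where P = "\<lambda>a b m k. metr Y (dseq Y a) (dseq Y b) < real m / (real k + 1)"])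
      (rule rec_presented_decidable[OF X] rec_presented_decidable[OF Y])+
  show "\<exists>i. metr (X \<times>\<^sub>r Y) (dseq (X \<times>\<^sub>r Y) i) x < r" if xr: "x \<in> pts (X \<times>\<^sub>r Y)" "0 < r" for x r
  proof -
    obtain a b where x: "x = Tup a b" "a \<in> pts X" "b \<in> pts Y" using xr(1) by auto
    obtain i where i: "metr X (dseq X i) a < r" using X x(2) xr(2) by (rule rec_presented_dense)
    obtain j where "metr Y (dseq Y j) b < r" using Y x(3) xr(2) by (rule rec_presented_dense)
    with i show ?thesis
      by (intro exI[of _ "tuple_code [i, j, 0]"]) (simp add: x)
  qed
  fix \<sigma> :: "nat \<Rightarrow> _"
  assume \<sigma>: "range \<sigma> \<subseteq> pts (X \<times>\<^sub>r Y)"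
    "\<forall>\<epsilon>>0. \<exists>N. \<forall>n n'. N \<le> n \<longrightarrow> N \<le> n' \<longrightarrow> metr (X \<times>\<^sub>r Y) (\<sigma> n) (\<sigma> n') < \<epsilon>"
  from \<sigma>(1) have "\<forall>n. \<exists>a b. \<sigma> n = Tup a b \<and> a \<in> pts X \<and> b \<in> pts Y"
    by (auto simp: image_subset_iff)
  then obtain s t where st: "\<And>n. \<sigma> n = Tup (s n) (t n)" "range s \<subseteq> pts X" "range t \<subseteq> pts Y"
    by (metis image_subsetI)
  have cauchy: "\<exists>N. \<forall>n n'. N \<le> n \<longrightarrow> N \<le> n' \<longrightarrow> metr X (s n) (s n') < \<epsilon> \<and> metr Y (t n) (t n') < \<epsilon>"
    if "\<epsilon> > 0" for \<epsilon>
    using \<sigma>(2)[rule_format, OF that] unfolding st(1) metr_prod max_less_iff_conj .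
  obtain k where k: "k \<in> pts X" "\<And>\<epsilon>. \<epsilon> > 0 \<Longrightarrow> \<exists>N. \<forall>n\<ge>N. metr X (s n) k < \<epsilon>"
    using rec_presented_complete[OF X st(2)] cauchy by blast
  obtain l where l: "l \<in> pts Y" "\<And>\<epsilon>. \<epsilon> > 0 \<Longrightarrow> \<exists>N. \<forall>n\<ge>N. metr Y (t n) l < \<epsilon>"
    using rec_presented_complete[OF Y st(3)] cauchy by blast
  have "\<exists>N. \<forall>n\<ge>N. metr (X \<times>\<^sub>r Y) (\<sigma> n) (Tup k l) < \<epsilon>" if "\<epsilon> > 0" for \<epsilon>
  proof -
    obtain N M where "\<forall>n\<ge>N. metr X (s n) k < \<epsilon>" "\<forall>n\<ge>M. metr Y (t n) l < \<epsilon>"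
      using k(2) l(2) \<open>\<epsilon> > 0\<close> by meson
    then show ?thesis by (intro exI[of _ "max N M"]) (simp add: st(1))
  qed
  then show "\<exists>l\<in>pts (X \<times>\<^sub>r Y). \<forall>\<epsilon>>0. \<exists>N. \<forall>n\<ge>N. metr (X \<times>\<^sub>r Y) (\<sigma> n) l < \<epsilon>"
    using k(1) l(1) by (intro bexI[of _ "Tup k l"]) auto
qed

section \<open>Semirecursive operators\<close>

text \<open>A total operator is represented by its graph: \<open>e 0\<close> is the argument,
  \<open>e 1\<close> the value, and the rest of the environment holds parameters.\<close>

definition semirec_op :: "((nat \<Rightarrow> nat) \<Rightarrow> (nat \<Rightarrow> nat) \<Rightarrow> nat \<Rightarrow> nat) \<Rightarrow> bool" where
  "semirec_op F \<longleftrightarrow> semirec (\<lambda>\<alpha> e. F \<alpha> (\<lambda>i. e (Suc (Suc i))) (e 0) = e 1)"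

lemma semirec_op_value:
  assumes "semirec_op F" "\<And>i. computable (\<lambda>e. H e i)" "computable f" "computable g"
  shows "semirec (\<lambda>\<alpha> e. F \<alpha> (H e) (f e) = g e)"
  using semirec_env[OF assms(1)[unfolded semirec_op_def], of "\<lambda>e. case_nat (f e) (case_nat (g e) (H e))"]
  by (simp add: computable_case_nat assms)

lemma semirec_op_env:
  assumes "semirec_op F" "\<And>i. computable (\<lambda>e. H e i)"
  shows "semirec_op (\<lambda>\<alpha> e. F \<alpha> (H e))"
  unfolding semirec_op_def
  using computable_env[OF assms(2), of "\<lambda>e i. e (Suc (Suc i))"]
  by (intro semirec_op_value[OF assms(1)]) (auto simp: computable_var)

lemma semirec_op_subst: "semirec R \<Longrightarrow> semirec_op F \<Longrightarrow> semirec (\<lambda>\<alpha> e. R (F \<alpha> e) e)"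
  unfolding semirec_op_def by (rule semirec_subst[of R F])

lemma semirec_op_subst_env:
  assumes "semirec R" "semirec_op F" "\<And>i. computable (\<lambda>e. H e i)" "\<And>i. computable (\<lambda>e. H' e i)"
  shows "semirec (\<lambda>\<alpha> e. R (F \<alpha> (H e)) (H' e))"
  using semirec_op_subst[OF semirec_env[OF assms(1,4)] semirec_op_env[OF assms(2,3)]] by simp

lemma semirec_op_comp:
  assumes "semirec_op F" "semirec_op A" "\<And>i. computable (\<lambda>e. H e i)"
  shows "semirec_op (\<lambda>\<alpha> e. F (A \<alpha> e) (H e))"
proof -
  have "semirec (\<lambda>\<alpha> e. (\<lambda>\<alpha> e. F \<alpha> (\<lambda>i. e (Suc (Suc i))) (e 0) = e 1) (A \<alpha> (\<lambda>i. e (Suc (Suc i))))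
      (case_nat (e 0) (case_nat (e 1) (H (\<lambda>i. e (Suc (Suc i)))))))"
    by (intro semirec_op_subst_env[OF assms(1)[unfolded semirec_op_def] assms(2)]
        computable_case_nat computable_var computable_env[OF assms(3)])
  then show ?thesis unfolding semirec_op_def by simp
qed

lemma semirec_op_oracle: "semirec_op (\<lambda>\<alpha> e. \<alpha>)"
  unfolding semirec_op_def by (intro semirec_oracle computable_var)

lemma semirec_op_computable:
  assumes "computable (\<lambda>e. f (\<lambda>i. e (Suc i)) (e 0))"
  shows "semirec_op (\<lambda>\<alpha> e. f e)"
proof -
  have "computable (\<lambda>e. f (\<lambda>i. e (Suc (Suc i))) (e 0))"
    using computable_env[OF assms, of "\<lambda>e. case_nat (e 0) (\<lambda>i. e (Suc (Suc i)))"]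
    by (simp add: computable_case_nat computable_var)
  then show ?thesis
    unfolding semirec_op_def by (intro semirec_decidable decidable_eq computable_var)
qed

lemma semirec_op_recursive_seq: "recursive_seq a \<Longrightarrow> semirec_op (\<lambda>\<alpha> e. a)"
  unfolding recursive_seq_iff by (rule semirec_op_computable)

section \<open>Interleaved sequences and streams of points\<close>

definition join :: "(nat \<Rightarrow> nat) \<Rightarrow> (nat \<Rightarrow> nat) \<Rightarrow> nat \<Rightarrow> nat" where
  "join \<alpha> \<beta> i = (if even i then \<alpha> (i div 2) else \<beta> (i div 2))"

definition left :: "(nat \<Rightarrow> nat) \<Rightarrow> nat \<Rightarrow> nat" where
  "left \<alpha> i = \<alpha> (2 * i)"

definition right :: "(nat \<Rightarrow> nat) \<Rightarrow> nat \<Rightarrow> nat" where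
  "right \<alpha> i = \<alpha> (2 * i + 1)"

lemma left_join [simp]: "left (join \<alpha> \<beta>) = \<alpha>"
  and right_join [simp]: "right (join \<alpha> \<beta>) = \<beta>"
  by (auto simp: left_def right_def join_def fun_eq_iff)

lemma computable_half:
  assumes "computable f" shows "computable (\<lambda>e. f e div 2)"
proof -
  have "\<exists>n. m < 2 * Suc n" for m
    by (rule exI[of _ m]) simp
  then have "computable (\<lambda>e. LEAST n. e 0 < 2 * Suc n)"
    by (intro computable_Least computable_intros)
  moreover have "(LEAST n. m < 2 * Suc n) = m div 2" for m
    by (rule Least_equality) auto
  ultimately show ?thesis using computable_apply1[OF _ assms, of "\<lambda>m. m div 2"] by simp
qed

lemma semirec_op_left:
  assumes "semirec_op F" shows "semirec_op (\<lambda>\<alpha> e. left (F \<alpha> e))"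
  unfolding semirec_op_def left_def
  by (intro semirec_op_value[OF assms] computable_intros)

lemma semirec_op_right:
  assumes "semirec_op F" shows "semirec_op (\<lambda>\<alpha> e. right (F \<alpha> e))"
  unfolding semirec_op_def right_def
  by (intro semirec_op_value[OF assms] computable_intros)

lemma semirec_op_Suc:
  assumes "semirec_op F" shows "semirec_op (\<lambda>\<alpha> e i. F \<alpha> e (Suc i))"
  unfolding semirec_op_def
  by (intro semirec_op_value[OF assms] computable_intros)

text \<open>The condition may depend on the oracle. Confirming a value includes confirming the
  branch, so both the condition and its complement are assumed semirecursive.\<close>

lemma semirec_cases:
  assumes "semirec P" "semirec (\<lambda>\<alpha> e. \<not> P \<alpha> e)" "semirec (\<lambda>\<alpha> e. f \<alpha> e = h e)" "semirec (\<lambda>\<alpha> e. g \<alpha> e = h e)"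
  shows "semirec (\<lambda>\<alpha> e. (if P \<alpha> e then f \<alpha> e else g \<alpha> e) = h e)"
proof -
  have "semirec (\<lambda>\<alpha> e. (P \<alpha> e \<and> f \<alpha> e = h e) \<or> (\<not> P \<alpha> e \<and> g \<alpha> e = h e))"
    by (intro semirec_disj semirec_conj assms)
  moreover have "(if P \<alpha> e then f \<alpha> e else g \<alpha> e) = h e \<longleftrightarrow>
      (P \<alpha> e \<and> f \<alpha> e = h e) \<or> (\<not> P \<alpha> e \<and> g \<alpha> e = h e)" for \<alpha> e
    by simp
  ultimately show ?thesis by simp
qed

lemma semirec_if:
  assumes "decidable P" "semirec (\<lambda>\<alpha> e. f \<alpha> e = h e)" "semirec (\<lambda>\<alpha> e. g \<alpha> e = h e)"
  shows "semirec (\<lambda>\<alpha> e. (if P e then f \<alpha> e else g \<alpha> e) = h e)"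
  by (intro semirec_cases semirec_decidable decidable_not assms)

lemma semirec_op_join:
  assumes "semirec_op F" "semirec_op F'"
  shows "semirec_op (\<lambda>\<alpha> e. join (F \<alpha> e) (F' \<alpha> e))"
  unfolding semirec_op_def join_def
  by (intro semirec_if semirec_op_value[OF assms(1)] semirec_op_value[OF assms(2)]
      computable_half computable_intros)

definition num_seq :: "nat \<Rightarrow> nat \<Rightarrow> nat" where
  "num_seq n i = (if i = 0 then n else 0)"

lemma num_seq_0 [simp]: "num_seq n 0 = n"
  by (simp add: num_seq_def)

lemma semirec_op_num_seq:
  assumes "computable f" shows "semirec_op (\<lambda>\<alpha> e. num_seq (f e))"
  unfolding num_seq_def
  by (intro semirec_op_computable computable_if decidable_eq computable_var computable_const
      computable_weaken[OF assms])

text \<open>The shape of the point is not recorded, since the space determines it.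
  \<open>Atom\<close> gets a dummy value: only products of \<omega> and Baire space are coded
  below.\<close>

primrec stream :: "'a point \<Rightarrow> nat \<Rightarrow> nat" where
  "stream (Atom a) = (\<lambda>_. 0)"
| "stream (Num n) = num_seq n"
| "stream (Fn \<alpha>) = \<alpha>"
| "stream (Tup x y) = join (stream x) (stream y)"

text \<open>Finitely many values of the sequence settle membership in a ball. The complement is
  stated too, because the case distinction in \<open>Sigma01_sections_op\<close> requires
  both.\<close>

lemma semirec_baire_ball:
  assumes "semirec_op F" "computable c" "computable m" "computable k"
  shows "semirec (\<lambda>\<alpha> e. baire_metric (Fn (nth_code (c e)) :: 'a point) (Fn (F \<alpha> e)) < real (m e) / (real (k e) + 1))"
    and "semirec (\<lambda>\<alpha> e. \<not> baire_metric (Fn (nth_code (c e)) :: 'a point) (Fn (F \<alpha> e)) < real (m e) / (real (k e) + 1))"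
proof -
  note w = computable_weaken[OF assms(2)] computable_weaken[OF assms(3)] computable_weaken[OF assms(4)]
  note ww = computable_weaken[OF w(1)] computable_weaken[OF w(2)] computable_weaken[OF w(3)]
  have "semirec (\<lambda>\<alpha> e. 0 < m e \<and> (\<forall>n<Suc (k e). Suc (k e) < m e * Suc n \<or> F \<alpha> e n = nth_code (c e) n))"
    by (intro semirec_conj_decidable semirec_all_less semirec_disj semirec_decidable
        semirec_op_value[OF assms(1)] computable_nth_code decidable_less computable_intros assms(2-) w)
  moreover have "baire_metric (Fn (nth_code (c e)) :: 'a point) (Fn (F \<alpha> e)) < real (m e) / (real (k e) + 1) \<longleftrightarrow>
     0 < m e \<and> (\<forall>n<Suc (k e). Suc (k e) < m e * Suc n \<or> F \<alpha> e n = nth_code (c e) n)" for \<alpha> e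
    unfolding baire_less_iff by (metis not_le)
  ultimately show "semirec (\<lambda>\<alpha> e. baire_metric (Fn (nth_code (c e)) :: 'a point) (Fn (F \<alpha> e)) < real (m e) / (real (k e) + 1))"
    by (simp only:)
  \<comment> \<open>Disagreement is confirmed by exhibiting a value x different from that of the
    centre, since \<open>semirec_op_value\<close> provides equations only.\<close>
  have "semirec (\<lambda>\<alpha> e. m e = 0 \<or> (\<exists>n. \<exists>x. (n < Suc (k e) \<and> m e * Suc n \<le> Suc (k e) \<and> x \<noteq> nth_code (c e) n) \<and> F \<alpha> e n = x))"
    by (intro semirec_disj semirec_decidable semirec_ex semirec_conj_decidable
        semirec_op_value[OF assms(1)] computable_nth_code computable_intros assms(2-) ww)
  moreover have "\<not> baire_metric (Fn (nth_code (c e)) :: 'a point) (Fn (F \<alpha> e)) < real (m e) / (real (k e) + 1) \<longleftrightarrow>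
     m e = 0 \<or> (\<exists>n. \<exists>x. (n < Suc (k e) \<and> m e * Suc n \<le> Suc (k e) \<and> x \<noteq> nth_code (c e) n) \<and> F \<alpha> e n = x)" for \<alpha> e
    unfolding baire_less_iff by (simp only: not_gr_zero de_Morgan_conj not_all not_imp) (metis (full_types))
  ultimately show "semirec (\<lambda>\<alpha> e. \<not> baire_metric (Fn (nth_code (c e)) :: 'a point) (Fn (F \<alpha> e)) < real (m e) / (real (k e) + 1))"
    by (simp only:)
qed

lemma semirec_mem_nbhd_baire:
  assumes "semirec_op F" "computable s"
  shows "semirec (\<lambda>\<alpha> e. Fn (F \<alpha> e) \<in> nbhd (baire :: 'a space) (s e))"
  unfolding mem_nbhd_iff[OF rec_presented_baire]
  using semirec_baire_ball(1)[where 'a = 'a, OF assms(1), of "\<lambda>e. nth_code (s e) 0" "\<lambda>e. nth_code (s e) 1" "\<lambda>e. nth_code (s e) 2"]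
  by (simp add: computable_nth_code assms(2) computable_const)

text \<open>The ball of radius 1/(j+1) around the sequence coded by c fixes the values up to j
  inclusive. Recursive maps and the functions {\<gamma>} are given through neighbourhoods of their
  values; this recovers the values by a search for c.\<close>

lemma eq_iff_mem_nbhd_baire:
  "\<beta> j = m \<longleftrightarrow> (\<exists>c. Fn \<beta> \<in> nbhd (baire :: 'a space) (tuple_code [c, 1, j]) \<and> nth_code c j = m)"
proof
  assume m: "\<beta> j = m"
  obtain c where c: "\<And>i. i < Suc j \<Longrightarrow> nth_code c i = \<beta> i" using ex_nth_code by blast
  then show "\<exists>c. Fn \<beta> \<in> nbhd (baire :: 'a space) (tuple_code [c, 1, j]) \<and> nth_code c j = m"
    using m by (intro exI[of _ c]) (simp add: mem_nbhd_iff[OF rec_presented_baire] baire_less_iff[where m = 1, simplified])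
next
  assume "\<exists>c. Fn \<beta> \<in> nbhd (baire :: 'a space) (tuple_code [c, 1, j]) \<and> nth_code c j = m"
  then obtain c where "Fn \<beta> \<in> nbhd (baire :: 'a space) (tuple_code [c, 1, j])" "nth_code c j = m" by blast
  then show "\<beta> j = m"
    by (auto simp: mem_nbhd_iff[OF rec_presented_baire] dest: baire_metric_less_imp_eq)
qed

section \<open>Coded spaces\<close>

text \<open>\<open>stream\<close> translates between \<open>\<Sigma>\<^sup>0\<^sub>1\<close> subsets of \<open>Z\<close> and semirecursive relations because balls are
  semirecursive in the stream of a point, while conversely small balls decide initial segments.\<close>

definition coded :: "'a space \<Rightarrow> bool" where
  "coded Z \<longleftrightarrow> rec_presented Z \<and>
     (\<exists>R. semirec R \<and> (\<forall>p\<in>pts Z. \<forall>e.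
        R (stream p) e \<longleftrightarrow> metr Z (dseq Z (e 0)) p < real (e 1) / (real (e 2) + 1))) \<and>
     (\<forall>p\<in>pts Z. \<forall>q\<in>pts Z. \<forall>n. metr Z p q < 1 / (real n + 1) \<longrightarrow>
        (\<forall>i<n. stream p i = stream q i)) \<and>
     computable (\<lambda>e. stream (dseq Z (e 0)) (e 1))"

lemma coded_rec_presented: "coded Z \<Longrightarrow> rec_presented Z"
  by (simp add: coded_def)

lemma coded_ball:
  assumes "coded Z"
  obtains R where "semirec R" "\<And>p e. p \<in> pts Z \<Longrightarrow>
    R (stream p) e \<longleftrightarrow> metr Z (dseq Z (e 0)) p < real (e 1) / (real (e 2) + 1)"
  using assms unfolding coded_def by blast

lemma coded_stream_eq:
  assumes "coded Z" "p \<in> pts Z" "q \<in> pts Z" "metr Z p q < 1 / (real n + 1)" "i < n"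
  shows "stream p i = stream q i"
  using assms unfolding coded_def by blast

lemma coded_computable:
  assumes "coded Z" "computable f" "computable g"
  shows "computable (\<lambda>e. stream (dseq Z (f e)) (g e))"
proof -
  have "computable (\<lambda>e. stream (dseq Z (e 0)) (e 1))"
    using assms(1) unfolding coded_def by blast
  from computable_apply2[OF this assms(2,3)] show ?thesis .
qed

lemma coded_baire: "coded (baire :: 'a space)"
  unfolding coded_def
proof (intro conjI ballI allI impI)
  show "rec_presented (baire :: 'a space)" by (rule rec_presented_baire)
  have "semirec (\<lambda>\<alpha> e. baire_metric (Fn (nth_code (e 0)) :: 'a point) (Fn \<alpha>) < real (e 1) / (real (e 2) + 1))"
    by (intro semirec_baire_ball semirec_op_oracle computable_var)
  then show "\<exists>R. semirec R \<and> (\<forall>p\<in>pts (baire :: 'a space). \<forall>e.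
        R (stream p) e \<longleftrightarrow> metr baire (dseq baire (e 0)) p < real (e 1) / (real (e 2) + 1))"
    by (intro exI conjI) auto
  show "computable (\<lambda>e. stream (dseq (baire :: 'a space) (e 0)) (e 1))"
    by (simp add: computable_nth_code computable_var)
  fix p q :: "'a point" and n i
  assume pq: "p \<in> pts baire" "q \<in> pts baire" "metr baire p q < 1 / (real n + 1)" "i < n"
  then obtain a b where ab: "p = Fn a" "q = Fn b" by auto
  have "1 / (real n + 1) \<le> 1 / (real i + 1)" using pq(4) by (simp add: field_simps)
  with pq(3) have "baire_metric (Fn a) (Fn b :: 'a point) < 1 / (real i + 1)"
    by (simp only: ab metr_baire)
  then show "stream p i = stream q i"
    using baire_metric_less_imp_eq by (simp add: ab)
qed

lemma coded_omega: "coded (omega :: 'a space)"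
  unfolding coded_def
proof (intro conjI ballI allI impI)
  show "rec_presented (omega :: 'a space)" by (rule rec_presented_omega)
  have "semirec (\<lambda>\<alpha> e. \<exists>x. (0 < e 1 \<and> (e 1 \<le> Suc (e 2) \<longrightarrow> e 0 = x)) \<and> \<alpha> 0 = x)"
    by (intro semirec_ex semirec_conj_decidable semirec_oracle computable_intros)
  then have R: "semirec (\<lambda>\<alpha> e. metr (omega :: 'a space) (Num (e 0)) (Num (\<alpha> 0)) < real (e 1) / (real (e 2) + 1))"
    unfolding omega_less_iff by simp
  show "\<exists>R. semirec R \<and> (\<forall>p\<in>pts (omega :: 'a space). \<forall>e.
        R (stream p) e \<longleftrightarrow> metr omega (dseq omega (e 0)) p < real (e 1) / (real (e 2) + 1))"
    using R by (intro exI conjI) (assumption, auto)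
  have "computable (\<lambda>e. if e 1 = 0 then e 0 else 0)"
    by (intro computable_intros)
  then show "computable (\<lambda>e. stream (dseq (omega :: 'a space) (e 0)) (e 1))"
    by (simp add: num_seq_def)
  fix p q :: "'a point" and n i
  assume pq: "p \<in> pts omega" "q \<in> pts omega" "metr omega p q < 1 / (real n + 1)" "i < n"
  then obtain a b where ab: "p = Num a" "q = Num b" by auto
  have "1 / (real n + 1) \<le> 1" by (simp add: field_simps)
  then show "stream p i = stream q i"
    using pq(3) by (auto simp: ab split: if_splits)
qed

lemma coded_prod:
  fixes X Y :: "'a space"
  assumes "coded X" "coded Y" shows "coded (X \<times>\<^sub>r Y)"
  unfolding coded_def
proof (intro conjI ballI allI impI)
  show "rec_presented (X \<times>\<^sub>r Y)" by (intro rec_presented_prod coded_rec_presented assms)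
  obtain R where R: "semirec R" "\<And>p e. p \<in> pts X \<Longrightarrow>
      R (stream p) e \<longleftrightarrow> metr X (dseq X (e 0)) p < real (e 1) / (real (e 2) + 1)"
    using coded_ball[OF assms(1)] by blast
  obtain R' where R': "semirec R'" "\<And>p e. p \<in> pts Y \<Longrightarrow>
      R' (stream p) e \<longleftrightarrow> metr Y (dseq Y (e 0)) p < real (e 1) / (real (e 2) + 1)"
    using coded_ball[OF assms(2)] by blast
  have env: "computable (\<lambda>e. (case j of 0 \<Rightarrow> nth_code (e 0) i | Suc j' \<Rightarrow> e (Suc j')))" for i j :: nat
    by (intro computable_case_nat computable_nth_code computable_var computable_const)
  have "semirec (\<lambda>\<alpha> e. R (left \<alpha>) (case_nat (nth_code (e 0) 0) (\<lambda>j. e (Suc j))) \<and>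
      R' (right \<alpha>) (case_nat (nth_code (e 0) 1) (\<lambda>j. e (Suc j))))"
    by (intro semirec_conj semirec_op_subst_env[OF R(1) semirec_op_left[OF semirec_op_oracle], where H = "\<lambda>e. e"]
        semirec_op_subst_env[OF R'(1) semirec_op_right[OF semirec_op_oracle], where H = "\<lambda>e. e"]
        computable_var env)
  then show "\<exists>R. semirec R \<and> (\<forall>p\<in>pts (X \<times>\<^sub>r Y). \<forall>e. R (stream p) e \<longleftrightarrow>
      metr (X \<times>\<^sub>r Y) (dseq (X \<times>\<^sub>r Y) (e 0)) p < real (e 1) / (real (e 2) + 1))"
    by (intro exI conjI) (assumption, auto simp: R(2) R'(2) numeral_2_eq_2)
  have "computable (\<lambda>e. if 2 dvd e 1 then stream (dseq X (nth_code (e 0) 0)) (e 1 div 2)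
      else stream (dseq Y (nth_code (e 0) 1)) (e 1 div 2))"
    by (intro computable_if decidable_dvd coded_computable[OF assms(1)] coded_computable[OF assms(2)]
        computable_half computable_nth_code computable_var computable_const)
  then show "computable (\<lambda>e. stream (dseq (X \<times>\<^sub>r Y) (e 0)) (e 1))"
    by (simp add: join_def One_nat_def[symmetric] del: One_nat_def)
  fix p q :: "'a point" and n i
  assume pq: "p \<in> pts (X \<times>\<^sub>r Y)" "q \<in> pts (X \<times>\<^sub>r Y)" "metr (X \<times>\<^sub>r Y) p q < 1 / (real n + 1)" "i < n"
  then obtain a b c d where ab: "p = Tup a b" "q = Tup c d"
    "a \<in> pts X" "b \<in> pts Y" "c \<in> pts X" "d \<in> pts Y" by auto
  have "metr X a c < 1 / (real n + 1)" "metr Y b d < 1 / (real n + 1)"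
    using pq(3) unfolding ab metr_prod max_less_iff_conj by blast+
  moreover have "i div 2 < n" using pq(4) by simp
  ultimately have "stream a (i div 2) = stream c (i div 2)" "stream b (i div 2) = stream d (i div 2)"
    using coded_stream_eq[OF assms(1)] coded_stream_eq[OF assms(2)] ab(3-) by blast+
  then show "stream p i = stream q i"
    by (simp add: ab join_def)
qed

lemma Sigma01_semirec:
  assumes "coded Z" "B \<in> Sigma01 Z"
  obtains R where "semirec R" "\<And>p e. p \<in> pts Z \<Longrightarrow> R (stream p) e \<longleftrightarrow> p \<in> B"
proof -
  obtain R where R: "semirec R" "\<And>p e. p \<in> pts Z \<Longrightarrow>
        R (stream p) e \<longleftrightarrow> metr Z (dseq Z (e 0)) p < real (e 1) / (real (e 2) + 1)"
    using assms(1) unfolding coded_def by blast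
  obtain \<epsilon> where \<epsilon>: "recursive_seq \<epsilon>" "B = (\<Union>i. nbhd Z (\<epsilon> i))"
    using assms(2) unfolding Sigma01_def by blast
  note Z = coded_rec_presented[OF assms(1)]
  have "semirec (\<lambda>\<alpha> e. \<exists>i. R \<alpha> (nth_code (\<epsilon> i)))"
    by (intro semirec_ex semirec_env[OF R(1)] computable_nth_code computable_recursive_seq[OF \<epsilon>(1)]
        computable_var computable_const)
  moreover have "(\<exists>i. R (stream p) (nth_code (\<epsilon> i))) \<longleftrightarrow> p \<in> B" if "p \<in> pts Z" for p
    using that by (simp add: \<epsilon>(2) R(2) mem_nbhd_iff[OF Z])
  ultimately show thesis by (rule that)
qed

text \<open>The set is exhausted by balls around dense points that agree with a segment s accepted
  by \<open>Q\<close>, of radius so small that every point of the ball still agrees with s.\<close>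

lemma semirec_Sigma01:
  assumes "coded Z" "semirec R"
  shows "{p \<in> pts Z. R (stream p) (\<lambda>_. 0)} \<in> Sigma01 Z"
proof -
  note Z = coded_rec_presented[OF assms(1)]
  interpret Metric_space "pts Z" "metr Z" using Z by (rule rec_presented_Metric_space)
  obtain Q where Q: "\<And>a b H. computable a \<Longrightarrow> computable b \<Longrightarrow> (\<And>i. computable (\<lambda>e. H e i)) \<Longrightarrow>
      decidable (\<lambda>e. Q (a e) (b e) (H e))"
    "\<And>\<alpha> e. R \<alpha> e \<longleftrightarrow> (\<exists>s w. agrees s \<alpha> \<and> Q s w e)"
    using semirecE[OF assms(2)] by blast
  define P where "P i \<longleftrightarrow> Q (nth_code i 0) (nth_code i 1) (\<lambda>_. 0) \<and>
    agrees (nth_code i 0) (stream (dseq Z (nth_code i 2)))" for i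
  \<comment> \<open>The radius is 1/(n+1) for n the length of s, matching
    \<open>coded_stream_eq\<close>. The default 0 codes a ball of radius 0, which is empty.\<close>
  define \<epsilon> where "\<epsilon> i = (if P i then tuple_code [nth_code i 2, 1, nth_code (nth_code i 0) 0] else 0)" for i
  have "computable (\<lambda>e. \<epsilon> (e 0))"
    unfolding \<epsilon>_def P_def agrees_def
    by (intro computable_if decidable_conj Q(1) decidable_all_less decidable_eq
        coded_computable[OF assms(1)]
        computable_tuple_code_3 computable_nth_code computable_Suc computable_var computable_const)
  then have "recursive_seq \<epsilon>" by (simp add: recursive_seq_iff)
  moreover have "{p \<in> pts Z. R (stream p) (\<lambda>_. 0)} = (\<Union>i. nbhd Z (\<epsilon> i))"
  proof (intro equalityI subsetI)
    fix p assume "p \<in> {p \<in> pts Z. R (stream p) (\<lambda>_. 0)}"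
    then obtain s w where p: "p \<in> pts Z" and s: "agrees s (stream p)" "Q s w (\<lambda>_. 0)"
      by (auto simp: Q(2))
    obtain c where c: "metr Z (dseq Z c) p < 1 / (real (nth_code s 0) + 1)"
      using rec_presented_dense[OF Z p, of "1 / (real (nth_code s 0) + 1)"] by auto
    have "agrees s (stream (dseq Z c))"
      using s(1) coded_stream_eq[OF assms(1) dseq_in_pts[OF Z] p c] by (simp add: agrees_def)
    then have "p \<in> nbhd Z (\<epsilon> (tuple_code [s, w, c]))"
      using s c p by (simp add: \<epsilon>_def P_def mem_nbhd_iff[OF Z])
    then show "p \<in> (\<Union>i. nbhd Z (\<epsilon> i))" by blast
  next
    fix p assume "p \<in> (\<Union>i. nbhd Z (\<epsilon> i))"
    then obtain i where i: "p \<in> nbhd Z (\<epsilon> i)" by blast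
    then have p: "p \<in> pts Z" by (simp add: mem_nbhd_iff[OF Z])
    have P: "P i"
    proof (rule ccontr)
      assume "\<not> P i"
      then have "metr Z (dseq Z 0) p < 0" using i by (simp add: \<epsilon>_def mem_nbhd_iff[OF Z])
      then show False using nonneg[of "dseq Z 0" p] by linarith
    qed
    then have "metr Z (dseq Z (nth_code i 2)) p < 1 / (real (nth_code (nth_code i 0) 0) + 1)"
      using i by (simp add: \<epsilon>_def mem_nbhd_iff[OF Z])
    from coded_stream_eq[OF assms(1) dseq_in_pts[OF Z] p this] have "agrees (nth_code i 0) (stream p)"
      using P by (simp add: P_def agrees_def)
    then show "p \<in> {p \<in> pts Z. R (stream p) (\<lambda>_. 0)}"
      using P p by (auto simp: Q(2) P_def)
  qed
  ultimately show ?thesis unfolding Sigma01_def by blast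
qed

text \<open>Here \<open>P\<close> gives the points at which \<open>S\<close> is evaluated,
  \<open>F\<close> their streams and \<open>T\<close> the resulting sequences. The graph of
  \<open>T\<close> is obtained by searching for a neighbourhood of the value that determines its
  j-th entry.\<close>

lemma semirec_op_recursive_map:
  fixes Z :: "'a space"
  assumes "coded Z" "recursive_map Z baire S" "semirec_op F"
    and P: "\<And>\<alpha> e. P \<alpha> e \<in> pts Z" "\<And>\<alpha> e. stream (P \<alpha> e) = F \<alpha> e" "\<And>\<alpha> e. S (P \<alpha> e) = Fn (T \<alpha> e)"
  shows "semirec_op T"
proof -
  have "coded (Z \<times>\<^sub>r omega)" by (intro coded_prod coded_omega assms)
  moreover have "{Tup x (Num k) | x k. x \<in> pts Z \<and> S x \<in> nbhd baire k} \<in> Sigma01 (Z \<times>\<^sub>r omega)"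
    using assms(2) by (simp add: recursive_map_def)
  ultimately obtain R where R: "semirec R" "\<And>p e. p \<in> pts (Z \<times>\<^sub>r omega) \<Longrightarrow>
      R (stream p) e \<longleftrightarrow> p \<in> {Tup x (Num k) | x k. x \<in> pts Z \<and> S x \<in> nbhd baire k}"
    using Sigma01_semirec by blast
  have R': "R (join (F \<alpha> e) (num_seq k)) e' \<longleftrightarrow> Fn (T \<alpha> e) \<in> (nbhd baire k :: 'a point set)" for \<alpha> e e' k
    using R(2)[of "Tup (P \<alpha> e) (Num k)" e'] P[of \<alpha> e] by simp
  have op: "semirec_op (\<lambda>\<alpha> e. join (F \<alpha> (\<lambda>i. e (Suc (Suc (Suc i))))) (num_seq (tuple_code [e 0, 1, e (Suc 0)])))"
    by (intro semirec_op_join semirec_op_env[OF assms(3)] semirec_op_num_seq computable_tuple_code_3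
        computable_const computable_var)
  have "semirec (\<lambda>\<alpha> e. \<exists>c. nth_code c (e 0) = e 1 \<and>
      R (join (F \<alpha> (\<lambda>i. e (Suc (Suc i)))) (num_seq (tuple_code [c, 1, e 0]))) (\<lambda>_. 0))"
    by (intro semirec_ex semirec_conj_decidable decidable_eq computable_nth_code computable_var
      semirec_op_subst_env[OF R(1) op, where H = "\<lambda>e. e"] computable_const)
  moreover have "T \<alpha> e j = m \<longleftrightarrow> (\<exists>c. nth_code c j = m \<and> R (join (F \<alpha> e) (num_seq (tuple_code [c, 1, j]))) (\<lambda>_. 0))" for \<alpha> e j m
    unfolding R' using eq_iff_mem_nbhd_baire[where 'a = 'a, of "T \<alpha> e" j m] by auto
  ultimately show ?thesis
    unfolding semirec_op_def by (simp only:)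
qed

lemma recursive_map_semirec_op:
  fixes Z :: "'a space"
  assumes "coded Z" "semirec_op F" "\<And>x. x \<in> pts Z \<Longrightarrow> f x = Fn (F (stream x) (\<lambda>_. 0))"
  shows "recursive_map Z baire f"
proof -
  \<comment> \<open>The neighbourhood index must be a computable term but is an entry of the oracle;
    it is guessed as k and compared with that entry.\<close>
  have "semirec (\<lambda>\<alpha> e. \<exists>k. Fn (F (left \<alpha>) (\<lambda>_. 0)) \<in> nbhd (baire :: 'a space) k \<and> right \<alpha> 0 = k)"
    by (intro semirec_ex semirec_conj semirec_mem_nbhd_baire semirec_op_comp[OF assms(2)]
        semirec_op_value[OF semirec_op_right[OF semirec_op_oracle], where H = "\<lambda>e. e"]
        semirec_op_left semirec_op_oracle computable_var computable_const)
  from semirec_Sigma01[OF coded_prod[OF assms(1) coded_omega] this]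
  have "{p \<in> pts (Z \<times>\<^sub>r omega). Fn (F (left (stream p)) (\<lambda>_. 0)) \<in> nbhd (baire :: 'a space) (right (stream p) 0)}
      \<in> Sigma01 (Z \<times>\<^sub>r omega)"
    by simp
  moreover have "{p \<in> pts (Z \<times>\<^sub>r omega). Fn (F (left (stream p)) (\<lambda>_. 0)) \<in> nbhd (baire :: 'a space) (right (stream p) 0)} =
      {Tup x (Num k) | x k. x \<in> pts Z \<and> f x \<in> nbhd baire k}"
    using assms(3) by auto
  ultimately show ?thesis
    unfolding recursive_map_def using assms(3) by auto
qed

section \<open>Borel codes\<close>

lemma nbhd_0: "rec_presented X \<Longrightarrow> nbhd X 0 = {}"
proof -
  assume X: "rec_presented X"
  interpret Metric_space "pts X" "metr X" using X by (rule rec_presented_Metric_space)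
  show ?thesis
    using nonneg[of "dseq X 0"] by (auto simp: mem_nbhd_iff[OF X] simp flip: not_le)
qed

lemma BC_level_1: "BC_level G 1 = {\<gamma>. \<gamma> 0 = 0}"
  using zero_less_one_countable_ordinal by (subst BC_level.simps) auto

lemma BC_level_iff:
  assumes "1 < \<xi>"
  shows "\<gamma> \<in> BC_level G \<xi> \<longleftrightarrow>
    \<gamma> 0 = 1 \<and> (\<forall>i. \<exists>\<epsilon> \<eta>. subcode G \<gamma> i \<epsilon> \<and> 1 \<le> \<eta> \<and> \<eta> < \<xi> \<and> \<epsilon> \<in> BC_level G \<eta>)"
proof -
  have "\<xi> \<noteq> 0" "\<xi> \<noteq> 1"
    using assms zero_less_one_countable_ordinal by auto
  then show ?thesis
    by (subst BC_level.simps) (simp add: Bex_def; meson)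
qed

lemma rho_open:
  assumes "\<gamma> 0 = 0"
  shows "rho G X \<gamma> = (\<Union>i. nbhd X (tail \<gamma> i))"
proof -
  have "\<gamma> \<in> BC_level G 1" using assms by (simp add: BC_level_1)
  moreover from this have "\<gamma> \<in> BC G" unfolding BC_def by auto
  ultimately show ?thesis by (subst rho.simps) simp
qed

lemma mem_rho_iff:
  assumes "\<gamma> \<in> BC_level G \<xi>" "1 < \<xi>" "\<And>i. subcode G \<gamma> i (\<epsilon> i)" "x \<in> pts X"
  shows "x \<in> rho G X \<gamma> \<longleftrightarrow> (\<exists>i. x \<notin> rho G X (\<epsilon> i))"
proof -
  have "\<gamma> 0 = 1" using assms(1) BC_level_iff[OF assms(2)] by blast
  then have "\<gamma> \<notin> BC_level G 1" by (simp add: BC_level_1)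
  moreover have "\<gamma> \<in> BC G" using assms(1,2) unfolding BC_def by auto
  moreover have "(THE \<epsilon>. subcode G \<gamma> i \<epsilon>) = \<epsilon> i" for i
    using assms(3) subcode_unique by blast
  ultimately show ?thesis
    using assms(4) by (subst rho.simps) simp
qed

lemma pfun_SomeD: "pfun G X Y \<delta> x = Some y \<Longrightarrow> is_value G X Y \<delta> x y"
  unfolding pfun_def by (metis (no_types, lifting) option.distinct(1) option.inject theI')

lemma subcode_iff:
  fixes G :: "'a space \<Rightarrow> 'a point set"
  shows "subcode G \<gamma> i \<beta> \<longleftrightarrow> (\<forall>k. Fn \<beta> \<in> nbhd (baire :: 'a space) k \<longleftrightarrow>
    Tup (Fn (tail \<gamma>)) (Tup (Num i) (Num k)) \<in> G (omega \<times>\<^sub>r omega))" (is "_ \<longleftrightarrow> ?R \<beta>")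
proof
  assume "subcode G \<gamma> i \<beta>"
  then show "?R \<beta>"
    unfolding subcode_def by (auto dest!: pfun_SomeD simp: is_value_def)
next
  assume R: "?R \<beta>"
  have val: "is_value G omega baire (tail \<gamma>) (Num i) y \<longleftrightarrow> (\<exists>\<beta>. y = Fn \<beta> \<and> ?R \<beta>)" for y
    unfolding is_value_def by auto
  \<comment> \<open>Neighbourhoods separate the points of Baire space, which gives the uniqueness
    that \<open>pfun\<close> demands.\<close>
  have "\<beta>' = \<beta>" if "?R \<beta>'" for \<beta>'
  proof
    fix j
    have "Fn \<beta>' \<in> nbhd (baire :: 'a space) k \<longleftrightarrow> Fn \<beta> \<in> nbhd (baire :: 'a space) k" for k
      using R that by blast
    then show "\<beta>' j = \<beta> j"
      using eq_iff_mem_nbhd_baire[where 'a = 'a, of \<beta>' j "\<beta> j"]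
        eq_iff_mem_nbhd_baire[where 'a = 'a, of \<beta> j "\<beta> j"] by simp
  qed
  then have "is_value G omega baire (tail \<gamma>) (Num i) = (\<lambda>y. y = Fn \<beta>)"
    using R unfolding fun_eq_iff val by blast
  then show "subcode G \<gamma> i \<beta>"
    unfolding subcode_def pfun_def by simp
qed

section \<open>Codes of preimages of open sets\<close>

lemma semirec_omega_ball:
  assumes "semirec_op F" "computable j" "computable b" "computable m" "computable k"
  shows "semirec (\<lambda>\<alpha> e. metr (omega :: 'a space) (Num (b e)) (Num (F \<alpha> e (j e))) < real (m e) / (real (k e) + 1))"
    and "semirec (\<lambda>\<alpha> e. \<not> metr (omega :: 'a space) (Num (b e)) (Num (F \<alpha> e (j e))) < real (m e) / (real (k e) + 1))"
proof -
  note w = assms(2-5)[THEN computable_weaken]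
  have "semirec (\<lambda>\<alpha> e. \<exists>x. (0 < m e \<and> (m e \<le> Suc (k e) \<longrightarrow> b e = x)) \<and> F \<alpha> e (j e) = x)"
    by (intro semirec_ex semirec_conj_decidable semirec_op_value[OF assms(1)] computable_intros w)
  then show "semirec (\<lambda>\<alpha> e. metr (omega :: 'a space) (Num (b e)) (Num (F \<alpha> e (j e))) < real (m e) / (real (k e) + 1))"
    unfolding omega_less_iff by simp
  have "semirec (\<lambda>\<alpha> e. \<exists>x. (\<not> (0 < m e \<and> (m e \<le> Suc (k e) \<longrightarrow> b e = x))) \<and> F \<alpha> e (j e) = x)"
    by (intro semirec_ex semirec_conj_decidable semirec_op_value[OF assms(1)] computable_intros w)
  then show "semirec (\<lambda>\<alpha> e. \<not> metr (omega :: 'a space) (Num (b e)) (Num (F \<alpha> e (j e))) < real (m e) / (real (k e) + 1))"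
    unfolding omega_less_iff by simp
qed

text \<open>Every ball in the enumeration of \<open>B\<close> splits into balls of Baire space, X
  and \<omega>. \<open>C\<close> lists the middle one if \<delta> and \<gamma>(i+1) lie in the outer
  two, and the empty neighbourhood 0 otherwise.\<close>

lemma Sigma01_sections_op:
  fixes X :: "'a space"
  assumes X: "rec_presented X" and B: "B \<in> Sigma01 (baire \<times>\<^sub>r X \<times>\<^sub>r omega)"
  obtains C where "semirec_op (\<lambda>\<alpha> e. C (left \<alpha>) (right \<alpha>))"
    "\<And>\<gamma> \<delta> x. x \<in> pts X \<Longrightarrow>
      (\<exists>n. x \<in> nbhd X (C \<gamma> \<delta> n)) \<longleftrightarrow> (\<exists>i. Tup (Fn \<delta>) (Tup x (Num (\<gamma> (Suc i)))) \<in> B)"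
proof -
  obtain \<epsilon> where \<epsilon>: "recursive_seq \<epsilon>" "B = (\<Union>i. nbhd (baire \<times>\<^sub>r X \<times>\<^sub>r omega) (\<epsilon> i))"
    using B unfolding Sigma01_def by blast
  \<comment> \<open>The number n codes a pair: a position i in the tail of \<gamma> and the index of
    a ball in the enumeration of \<open>B\<close>. Its centre is decoded along the nesting of the
    product into \<open>a\<close>, \<open>b\<close>, \<open>c\<close>; \<open>m\<close> and
    \<open>k\<close> give the common radius.\<close>
  define s where "s n = \<epsilon> (nth_code n 1)" for n
  define a where "a n = nth_code (nth_code (s n) 0) 0" for n
  define b where "b n = nth_code (nth_code (nth_code (s n) 0) 1) 0" for n
  define c where "c n = nth_code (nth_code (nth_code (s n) 0) 1) 1" for n
  define m where "m n = nth_code (s n) 1" for n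
  define k where "k n = nth_code (s n) 2" for n
  have comp: "computable (\<lambda>e. s (e 0))"
    unfolding s_def by (intro computable_recursive_seq[OF \<epsilon>(1)] computable_nth_code computable_var computable_const)
  have comps: "computable (\<lambda>e. a (e 0))" "computable (\<lambda>e. b (e 0))" "computable (\<lambda>e. c (e 0))"
    "computable (\<lambda>e. m (e 0))" "computable (\<lambda>e. k (e 0))"
    unfolding a_def b_def c_def m_def k_def
    by (intro computable_nth_code comp computable_const)+
  define P where "P \<gamma> \<delta> n \<longleftrightarrow>
    baire_metric (Fn (nth_code (a n)) :: 'a point) (Fn \<delta>) < real (m n) / (real (k n) + 1) \<and>
    metr (omega :: 'a space) (Num (c n)) (Num (\<gamma> (Suc (nth_code n 0)))) < real (m n) / (real (k n) + 1)" for \<gamma> \<delta> n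
  define C where "C \<gamma> \<delta> n = (if P \<gamma> \<delta> n then tuple_code [b n, m n, k n] else 0)" for \<gamma> \<delta> n
  note ops = semirec_op_left[OF semirec_op_oracle] semirec_op_right[OF semirec_op_oracle]
  note j = computable_Suc[OF computable_nth_code[OF computable_var[of 0] computable_const[of 0]]]
  have "semirec (\<lambda>\<alpha> e. P (left \<alpha>) (right \<alpha>) (e 0))"
    unfolding P_def
    by (intro semirec_conj semirec_baire_ball(1)[OF ops(2)] semirec_omega_ball(1)[OF ops(1)] comps j)
  moreover have "semirec (\<lambda>\<alpha> e. \<not> P (left \<alpha>) (right \<alpha>) (e 0))"
    unfolding P_def de_Morgan_conj
    by (intro semirec_disj semirec_baire_ball(2)[OF ops(2)] semirec_omega_ball(2)[OF ops(1)] comps j)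
  ultimately have "semirec_op (\<lambda>\<alpha> e. C (left \<alpha>) (right \<alpha>))"
    unfolding semirec_op_def C_def
    by (intro semirec_cases semirec_decidable decidable_eq computable_tuple_code_3 comps
        computable_const computable_var)
  moreover have "(\<exists>n. x \<in> nbhd X (C \<gamma> \<delta> n)) \<longleftrightarrow> (\<exists>i. Tup (Fn \<delta>) (Tup x (Num (\<gamma> (Suc i)))) \<in> B)"
    if x: "x \<in> pts X" for \<gamma> \<delta> x
  proof -
    have eq: "x \<in> nbhd X (C \<gamma> \<delta> n) \<longleftrightarrow>
        Tup (Fn \<delta>) (Tup x (Num (\<gamma> (Suc (nth_code n 0))))) \<in> nbhd (baire \<times>\<^sub>r X \<times>\<^sub>r omega) (\<epsilon> (nth_code n 1))" for n
    proof -
      have "x \<in> nbhd X (C \<gamma> \<delta> n) \<longleftrightarrow> P \<gamma> \<delta> n \<and> metr X (dseq X (b n)) x < real (m n) / (real (k n) + 1)"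
        using x by (cases "P \<gamma> \<delta> n") (simp_all add: C_def nbhd_0[OF X] mem_nbhd_iff[OF X, of _ "tuple_code _"])
      moreover have "rec_presented (baire \<times>\<^sub>r X \<times>\<^sub>r omega)"
        by (intro rec_presented_prod rec_presented_baire X rec_presented_omega)
      ultimately show ?thesis
        unfolding mem_nbhd_iff[OF \<open>rec_presented (baire \<times>\<^sub>r X \<times>\<^sub>r omega)\<close>] dseq_prod metr_prod
          max_less_iff_conj dseq_baire dseq_omega metr_baire s_def[symmetric]
          a_def[symmetric] b_def[symmetric] c_def[symmetric] m_def[symmetric] k_def[symmetric]
        using x unfolding P_def by auto
    qed
    show ?thesis
    proof
      assume "\<exists>n. x \<in> nbhd X (C \<gamma> \<delta> n)"
      then show "\<exists>i. Tup (Fn \<delta>) (Tup x (Num (\<gamma> (Suc i)))) \<in> B"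
        unfolding eq \<epsilon>(2) by blast
    next
      assume "\<exists>i. Tup (Fn \<delta>) (Tup x (Num (\<gamma> (Suc i)))) \<in> B"
      then obtain i l where "Tup (Fn \<delta>) (Tup x (Num (\<gamma> (Suc i)))) \<in> nbhd (baire \<times>\<^sub>r X \<times>\<^sub>r omega) (\<epsilon> l)"
        unfolding \<epsilon>(2) by blast
      then have "x \<in> nbhd X (C \<gamma> \<delta> (tuple_code [i, l, 0]))"
        unfolding eq by simp
      then show "\<exists>n. x \<in> nbhd X (C \<gamma> \<delta> n)" by blast
    qed
  qed
  ultimately show thesis by (rule that)
qed

section \<open>The properties of the good parametrization in use\<close>

lemma good_parametrization_Sigma01:
  assumes "good_parametrization G" "rec_presented Z"
  shows "G Z \<in> Sigma01 (baire \<times>\<^sub>r Z)"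
  using assms unfolding good_parametrization_def by simp

lemma good_parametrization_recursive:
  assumes "good_parametrization G" "rec_presented Z" "P \<in> Sigma01 Z" "P \<subseteq> pts Z"
  obtains \<gamma> where "recursive_seq \<gamma>" "P = section_at G Z \<gamma>"
proof -
  have "\<forall>P \<subseteq> pts Z. P \<in> Sigma01 Z \<longleftrightarrow> (\<exists>\<gamma>. recursive_seq \<gamma> \<and> P = section_at G Z \<gamma>)"
    using conjunct1[OF assms(1)[unfolded good_parametrization_def], THEN spec[of _ Z], THEN mp, OF assms(2)]
    by (elim conjE)
  with assms(3,4) that show thesis by auto
qed

lemma good_parametrization_smn:
  assumes "good_parametrization G" "type_le_1 X" "rec_presented Y"
  obtains S where "recursive_map (baire \<times>\<^sub>r X) baire S"
    "\<And>\<gamma> x y. x \<in> pts X \<Longrightarrow> y \<in> pts Y \<Longrightarrow>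
      Tup (Fn \<gamma>) (Tup x y) \<in> G (X \<times>\<^sub>r Y) \<longleftrightarrow> Tup (S (Tup (Fn \<gamma>) x)) y \<in> G Y"
proof -
  have "\<exists>S. recursive_map (baire \<times>\<^sub>r X) baire S \<and> (\<forall>\<gamma>. \<forall>x \<in> pts X. \<forall>y \<in> pts Y.
      Tup (Fn \<gamma>) (Tup x y) \<in> G (X \<times>\<^sub>r Y) \<longleftrightarrow> Tup (S (Tup (Fn \<gamma>) x)) y \<in> G Y)"
    using assms unfolding good_parametrization_def by (elim conjE) simp
  then show thesis using that by auto
qed

theorem lemma3p3:
  fixes G :: "'a space \<Rightarrow> 'a point set" and X Y :: "'a space"
  assumes "good_parametrization G" and "rec_presented X" and "rec_presented Y"
  shows "\<exists>u :: (nat \<Rightarrow> nat) \<Rightarrow> (nat \<Rightarrow> nat) \<Rightarrow> (nat \<Rightarrow> nat).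
    recursive_map (baire \<times>\<^sub>r baire :: 'a space) baire (on_points u) \<and>
    (\<forall>\<xi> \<ge> 1. \<forall>\<gamma> \<in> BC_level G \<xi>. \<forall>\<delta>.
       u \<gamma> \<delta> \<in> BC_level G \<xi> \<and>
       (\<forall>x \<in> pts X. \<forall>y. pfun G X Y \<delta> x = Some y \<longrightarrow>
          (x \<in> rho G X (u \<gamma> \<delta>) \<longleftrightarrow> y \<in> rho G Y \<gamma>)))"
proof -
  let ?I = "omega \<times>\<^sub>r omega :: 'a space"
  let ?B = "baire \<times>\<^sub>r baire \<times>\<^sub>r baire :: 'a space"
  have coded_I: "coded ?I" and coded_B: "coded ?B"
    by (intro coded_prod coded_omega coded_baire)+
  have coded_BI: "coded (?B \<times>\<^sub>r ?I)" and coded_baire_I: "coded (baire \<times>\<^sub>r ?I)"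
    and coded_baire_B: "coded (baire \<times>\<^sub>r ?B)"
    by (intro coded_prod coded_omega coded_baire)+
  have G_Sigma01: "G Z \<in> Sigma01 (baire \<times>\<^sub>r Z)" if "rec_presented Z" for Z
    using assms(1) that by (rule good_parametrization_Sigma01)

  obtain C where C: "semirec_op (\<lambda>\<alpha> e. C (left \<alpha>) (right \<alpha>))"
    "\<And>\<gamma> \<delta> x. x \<in> pts X \<Longrightarrow>
      (\<exists>n. x \<in> nbhd X (C \<gamma> \<delta> n)) \<longleftrightarrow> (\<exists>i. Tup (Fn \<delta>) (Tup x (Num (\<gamma> (Suc i)))) \<in> G (X \<times>\<^sub>r omega))"
    using Sigma01_sections_op[OF assms(2) G_Sigma01[OF rec_presented_prod[OF assms(2) rec_presented_omega]]]
    by blast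

  have "type_le_1 ?B" by (intro type_le_1.intros)
  obtain S where S: "recursive_map (baire \<times>\<^sub>r ?B) baire S"
    "\<And>\<gamma> x y. x \<in> pts ?B \<Longrightarrow> y \<in> pts ?I \<Longrightarrow>
      Tup (Fn \<gamma>) (Tup x y) \<in> G (?B \<times>\<^sub>r ?I) \<longleftrightarrow> Tup (S (Tup (Fn \<gamma>) x)) y \<in> G ?I"
    using good_parametrization_smn[OF assms(1) \<open>type_le_1 ?B\<close> coded_rec_presented[OF coded_I]] by blast
  \<comment> \<open>For \<alpha> coding (\<epsilon>,(\<gamma>,\<delta>)) this is
    (\<epsilon>,(\<epsilon>,\<gamma>,\<delta>)); the repeated \<open>left \<alpha>\<close> is the
    self-application of the recursion theorem.\<close>
  define point where "point \<alpha> = (Tup (Fn (left \<alpha>)) (Tup (Fn (left \<alpha>))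
    (Tup (Fn (left (right \<alpha>))) (Fn (right (right \<alpha>))))) :: 'a point)" for \<alpha>
  have "S (point \<alpha>) \<in> range Fn" for \<alpha>
    using S(1) unfolding recursive_map_def by (auto simp: point_def Pi_iff)
  then have "\<forall>\<alpha>. \<exists>\<tau>. S (point \<alpha>) = Fn \<tau>" by blast
  then obtain T where T: "\<And>\<alpha>. S (point \<alpha>) = Fn (T \<alpha>)" by metis
  note left = semirec_op_left[OF semirec_op_oracle] and right = semirec_op_right[OF semirec_op_oracle]
  have "semirec_op (\<lambda>\<alpha> e. join (left \<alpha>) (join (left \<alpha>) (join (left (right \<alpha>)) (right (right \<alpha>)))))"
    by (intro semirec_op_join semirec_op_left semirec_op_right semirec_op_oracle)
  from semirec_op_recursive_map[OF coded_baire_B S(1) this, of "\<lambda>\<alpha> e. point \<alpha>" "\<lambda>\<alpha> e. T \<alpha>"]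
  have T_op: "semirec_op (\<lambda>\<alpha> e. T \<alpha>)"
    by (simp add: T) (simp add: point_def)

  \<comment> \<open>\<open>V (join \<epsilon> (join \<gamma> \<delta>))\<close> is \<open>v(\<epsilon>,\<gamma>,\<delta>)\<close>.\<close>
  define V where "V \<alpha> j =
    (if left (right \<alpha>) 0 = 0 then if j = 0 then 0 else C (left (right \<alpha>)) (right (right \<alpha>)) (j - 1)
     else if j = 0 then 1 else T \<alpha> (j - 1))" for \<alpha> j
  \<comment> \<open>Guessing \<gamma>(0) as x makes the outer condition decidable. Position 0 holds
    the leading number of a Borel code, so the other positions are shifted by one.\<close>
  have "semirec (\<lambda>\<alpha> e. \<exists>x. left (right \<alpha>) 0 = x \<and>
      (if x = 0 then if e 0 = 0 then 0 else C (left (right \<alpha>)) (right (right \<alpha>)) (e 0 - 1)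
       else if e 0 = 0 then 1 else T \<alpha> (e 0 - 1)) = e 1)"
    by (intro semirec_ex semirec_conj semirec_if semirec_decidable decidable_eq computable_diff
        semirec_op_value[OF semirec_op_left[OF right], where H = "\<lambda>e. e"]
        semirec_op_value[OF semirec_op_comp[OF C(1) right, where H = "\<lambda>e. e"], where H = "\<lambda>e. e"]
        semirec_op_value[OF T_op, where H = "\<lambda>e. e"] computable_var computable_const)
  then have V_op: "semirec_op (\<lambda>\<alpha> e. V \<alpha>)"
    unfolding semirec_op_def V_def by simp

  obtain W where W: "semirec W" "\<And>p e. p \<in> pts (baire \<times>\<^sub>r ?I) \<Longrightarrow> W (stream p) e \<longleftrightarrow> p \<in> G ?I"
    using Sigma01_semirec[OF coded_baire_I G_Sigma01[OF coded_rec_presented[OF coded_I]]] by blast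
  \<comment> \<open>For \<open>\<alpha>\<close> the stream of \<open>((\<epsilon>,\<gamma>,\<delta>),(i,k))\<close>, \<open>gr \<alpha>\<close> is the graph of \<open>{\<gamma>\<^sup>*}(i)\<close> if this is defined.\<close>
  define gr where "gr \<alpha> j m \<longleftrightarrow> (\<exists>c. nth_code c j = m \<and>
    W (join (\<lambda>n. left (right (left \<alpha>)) (Suc n)) (join (left (right \<alpha>)) (num_seq (tuple_code [c, 1, j])))) (\<lambda>_. 0))"
    for \<alpha> j m
  have W_op: "semirec_op (\<lambda>\<alpha> e. join (\<lambda>n. left (right (left \<alpha>)) (Suc n))
      (join (left (right \<alpha>)) (num_seq (tuple_code [e 0, 1, e 1]))))"
    by (intro semirec_op_join semirec_op_Suc[of "\<lambda>\<alpha> e. left (right (left \<alpha>))"] semirec_op_left semirec_op_right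
        semirec_op_oracle semirec_op_num_seq computable_tuple_code_3 computable_var computable_const)
  have "semirec (\<lambda>\<alpha> e. gr \<alpha> (e 0) (e 1))"
    using semirec_op_subst_env[OF W(1) W_op, of "\<lambda>e. e" "\<lambda>_ _. 0"]
    unfolding gr_def
    by (intro semirec_ex semirec_conj_decidable decidable_eq computable_nth_code computable_var)
      (simp add: computable_var computable_const)
  then have gr: "semirec (\<lambda>\<alpha> e. gr \<alpha> (f e) (g e))" if "computable f" "computable g" for f g
    using semirec_env[of "\<lambda>\<alpha> e. gr \<alpha> (e 0) (e 1)" "\<lambda>e. case_nat (f e) (\<lambda>_. g e)"] that
    by (simp add: computable_case_nat)
  \<comment> \<open>The graph of \<open>join \<alpha> \<beta>\<close> for \<beta> with graph
    \<open>gr \<alpha>\<close>: the substituted oracle keeps the old data beside the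
    subcode.\<close>
  define join_gr where "join_gr \<alpha> j m \<longleftrightarrow>
    (2 dvd j \<and> \<alpha> (j div 2) = m) \<or> (\<not> 2 dvd j \<and> gr \<alpha> (j div 2) m)" for \<alpha> j m
  have join_gr: "semirec (\<lambda>\<alpha> e. join_gr \<alpha> (e 0) (e 1))"
    unfolding join_gr_def
    by (intro semirec_disj semirec_conj_decidable semirec_oracle gr decidable_not decidable_dvd
        computable_half computable_var computable_const)
  have join_gr_iff: "join_gr \<alpha> j m \<longleftrightarrow> join \<alpha> \<beta> j = m"
    if "\<And>j m. gr \<alpha> j m \<longleftrightarrow> \<beta> j = m" for \<alpha> \<beta> j m
    using that by (auto simp: join_gr_def join_def)
  \<comment> \<open>The left half of this oracle is meant to be the stream of
    ((\<epsilon>,\<gamma>,\<delta>),(i,k)), the right half the subcode \<beta>. The projections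
    select \<epsilon>, \<beta>, \<delta> and k, so the relation says that
    v(\<epsilon>,\<beta>,\<delta>) lies in the k-th neighbourhood.\<close>
  have "semirec (\<lambda>\<alpha> e. \<exists>k. Fn (V (join (left (left (left \<alpha>))) (join (right \<alpha>) (right (right (left (left \<alpha>)))))))
      \<in> nbhd (baire :: 'a space) k \<and> right (right (left \<alpha>)) 0 = k)"
    by (intro semirec_ex semirec_conj semirec_mem_nbhd_baire semirec_op_comp[OF V_op, where H = "\<lambda>e. e"] semirec_op_join
        semirec_op_left semirec_op_right semirec_op_oracle computable_var computable_const
        semirec_op_value[OF semirec_op_right[OF semirec_op_right[OF left]], where H = "\<lambda>e. e"])
  then have "semirec (\<lambda>\<alpha> e. Fn (V (join (left (left (left \<alpha>))) (join (right \<alpha>) (right (right (left (left \<alpha>)))))))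
      \<in> nbhd (baire :: 'a space) (right (right (left \<alpha>)) 0))"
    by simp
  from semirec_subst_rel[OF this, where F = "\<lambda>\<alpha> j m e. join_gr \<alpha> j m", OF join_gr]
  obtain R where R: "semirec R"
    "\<And>\<alpha> e f. (\<And>j m. join_gr \<alpha> j m \<longleftrightarrow> f j = m) \<Longrightarrow> R \<alpha> e \<longleftrightarrow>
      Fn (V (join (left (left (left f))) (join (right f) (right (right (left (left f)))))))
      \<in> nbhd (baire :: 'a space) (right (right (left f)) 0)"
    by blast
  \<comment> \<open>Where {\<gamma>*}(i) is undefined, membership in \<open>P\<close> has no
    intended meaning; \<open>u_subcode\<close> consults \<open>P\<close> only where it is
    defined.\<close>
  define P where "P = {p \<in> pts (?B \<times>\<^sub>r ?I). R (stream p) (\<lambda>_. 0)}"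
  have "P \<in> Sigma01 (?B \<times>\<^sub>r ?I)" "P \<subseteq> pts (?B \<times>\<^sub>r ?I)"
    unfolding P_def using semirec_Sigma01[OF coded_BI R(1)] by blast+
  then obtain e\<^sub>0 where e\<^sub>0: "recursive_seq e\<^sub>0" "P = section_at G (?B \<times>\<^sub>r ?I) e\<^sub>0"
    using good_parametrization_recursive[OF assms(1) coded_rec_presented[OF coded_BI]] by blast

  define u where "u \<gamma> \<delta> = V (join e\<^sub>0 (join \<gamma> \<delta>))" for \<gamma> \<delta>
  have "semirec_op (\<lambda>\<alpha> e. V (join e\<^sub>0 \<alpha>))"
    by (intro semirec_op_comp[OF V_op, where H = "\<lambda>e. e"] semirec_op_join semirec_op_recursive_seq e\<^sub>0 semirec_op_oracle computable_var)
  then have u_rec: "recursive_map (baire \<times>\<^sub>r baire :: 'a space) baire (on_points u)"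
    by (rule recursive_map_semirec_op[rotated]) (auto simp: u_def intro: coded_prod coded_baire)

  \<comment> \<open>The fixed-point equation: \<open>P\<close> is coded by \<open>e\<^sub>0\<close>
    and evaluated at \<epsilon> = \<open>e\<^sub>0\<close>, so the v occurring in it becomes u
    itself.\<close>
  have u_subcode: "subcode G (u \<gamma> \<delta>) i (u \<beta> \<delta>)" if "\<gamma> 0 \<noteq> 0" "subcode G \<gamma> i \<beta>" for \<gamma> \<delta> \<beta> i
  proof -
    define \<tau> where "\<tau> = T (join e\<^sub>0 (join \<gamma> \<delta>))"
    have "tail (u \<gamma> \<delta>) = \<tau>"
      using that(1) by (auto simp: fun_eq_iff tail_def u_def V_def \<tau>_def)
    moreover have "Fn (u \<beta> \<delta>) \<in> nbhd (baire :: 'a space) k \<longleftrightarrow> Tup (Fn \<tau>) (Tup (Num i) (Num k)) \<in> G ?I" for k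
    proof -
      let ?p = "Tup (Fn e\<^sub>0) (Tup (Fn \<gamma>) (Fn \<delta>)) :: 'a point" and ?q = "Tup (Num i) (Num k) :: 'a point"
      have "Tup (Fn \<tau>) ?q \<in> G ?I \<longleftrightarrow> Tup (S (Tup (Fn e\<^sub>0) ?p)) ?q \<in> G ?I"
        using T[of "join e\<^sub>0 (join \<gamma> \<delta>)"] by (simp add: point_def \<tau>_def)
      also have "\<dots> \<longleftrightarrow> Tup (Fn e\<^sub>0) (Tup ?p ?q) \<in> G (?B \<times>\<^sub>r ?I)"
        by (rule S(2)[symmetric]) auto
      also have "\<dots> \<longleftrightarrow> Tup ?p ?q \<in> P"
        unfolding e\<^sub>0(2) section_at_def by simp
      also have "\<dots> \<longleftrightarrow> R (stream (Tup ?p ?q)) (\<lambda>_. 0)"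
        unfolding P_def by simp
      also have "\<dots> \<longleftrightarrow> Fn (u \<beta> \<delta>) \<in> nbhd (baire :: 'a space) k"
      proof -
        have "gr (stream (Tup ?p ?q)) j m \<longleftrightarrow> \<beta> j = m" for j m
        proof -
          have "W (join (tail \<gamma>) (join (num_seq i) (num_seq l))) (\<lambda>_. 0) \<longleftrightarrow> Fn \<beta> \<in> nbhd (baire :: 'a space) l" for l
            using W(2)[of "Tup (Fn (tail \<gamma>)) (Tup (Num i) (Num l))" "\<lambda>_. 0"] that(2)
            unfolding subcode_iff by simp
          moreover have "(\<lambda>n. \<gamma> (Suc n)) = tail \<gamma>"
            by (simp add: fun_eq_iff tail_def)
          ultimately show ?thesis
            using eq_iff_mem_nbhd_baire[where 'a = 'a, of \<beta> j m] by (auto simp: gr_def)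
        qed
        from R(2)[of "stream (Tup ?p ?q)" "join (stream (Tup ?p ?q)) \<beta>", OF join_gr_iff[OF this]]
        show ?thesis by (simp add: u_def)
      qed
      finally show ?thesis by blast
    qed
    ultimately show ?thesis
      unfolding subcode_iff by simp
  qed

  \<comment> \<open>All subcodes are transformed with the same \<delta>, so the induction keeps it
    fixed and varies only \<gamma>.\<close>
  have main: "u \<gamma> \<delta> \<in> BC_level G \<xi> \<and> (\<forall>x \<in> pts X. \<forall>y. pfun G X Y \<delta> x = Some y \<longrightarrow>
      (x \<in> rho G X (u \<gamma> \<delta>) \<longleftrightarrow> y \<in> rho G Y \<gamma>))"
    if "\<gamma> \<in> BC_level G \<xi>" "1 \<le> \<xi>" for \<gamma> \<xi> \<delta>
    using that
  proof (induction \<xi> arbitrary: \<gamma> rule: less_induct)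
    case (less \<xi>)
    show ?case
    proof (cases "\<xi> = 1")
      case True
      then have \<gamma>: "\<gamma> 0 = 0" using less.prems by (simp add: BC_level_1)
      then have u: "u \<gamma> \<delta> 0 = 0" "tail (u \<gamma> \<delta>) n = C \<gamma> \<delta> n" for n
        by (simp_all add: u_def V_def tail_def)
      have "x \<in> rho G X (u \<gamma> \<delta>) \<longleftrightarrow> y \<in> rho G Y \<gamma>"
        if "x \<in> pts X" "pfun G X Y \<delta> x = Some y" for x y
        \<comment> \<open>Since y is the value of {\<delta>} at x, it lies in the neighbourhood with
          index \<gamma>(i+1) iff (\<delta>,x,\<gamma>(i+1)) is in G, and \<open>C\<close> lists the
          union of these sections.\<close>
        using C(2)[OF that(1), of \<gamma> \<delta>] pfun_SomeD[OF that(2)]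
        by (simp add: rho_open \<gamma> u is_value_def tail_def[of \<gamma>])
      then show ?thesis using u(1) True by (simp add: BC_level_1)
    next
      case False
      then have \<xi>: "1 < \<xi>" using less.prems by simp
      from less.prems(1) have \<gamma>: "\<gamma> 0 = 1"
        and "\<forall>i. \<exists>\<epsilon> \<eta>. subcode G \<gamma> i \<epsilon> \<and> 1 \<le> \<eta> \<and> \<eta> < \<xi> \<and> \<epsilon> \<in> BC_level G \<eta>"
        unfolding BC_level_iff[OF \<xi>] by blast+
      then obtain \<epsilon> \<eta> where \<epsilon>: "\<And>i. subcode G \<gamma> i (\<epsilon> i)"
        and \<eta>: "\<And>i. 1 \<le> \<eta> i" "\<And>i. \<eta> i < \<xi>" "\<And>i. \<epsilon> i \<in> BC_level G (\<eta> i)" by metis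
      have sub: "subcode G (u \<gamma> \<delta>) i (u (\<epsilon> i) \<delta>)" for i
        using \<gamma> \<epsilon> by (intro u_subcode) auto
      have IH: "u (\<epsilon> i) \<delta> \<in> BC_level G (\<eta> i)"
        "x \<in> pts X \<Longrightarrow> pfun G X Y \<delta> x = Some y \<Longrightarrow> x \<in> rho G X (u (\<epsilon> i) \<delta>) \<longleftrightarrow> y \<in> rho G Y (\<epsilon> i)" for i x y
        using less.IH[OF \<eta>(2) \<eta>(3) \<eta>(1)] by blast+
      have "u \<gamma> \<delta> 0 = 1" by (simp add: u_def V_def \<gamma>)
      then have u: "u \<gamma> \<delta> \<in> BC_level G \<xi>"
        unfolding BC_level_iff[OF \<xi>] using sub \<eta> IH(1) by blast
      have "x \<in> rho G X (u \<gamma> \<delta>) \<longleftrightarrow> y \<in> rho G Y \<gamma>"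
        if x: "x \<in> pts X" "pfun G X Y \<delta> x = Some y" for x y
      proof -
        \<comment> \<open>The complements in \<rho>(\<gamma>) are taken inside Y, so y has to be a
          point of Y.\<close>
        have "y \<in> pts Y" using pfun_SomeD[OF x(2)] by (simp add: is_value_def)
        then show ?thesis
          using mem_rho_iff[OF u \<xi> sub x(1)] mem_rho_iff[OF less.prems(1) \<xi> \<epsilon>] IH(2)[OF x] by blast
      qed
      then show ?thesis using u by blast
    qed
  qed
  show ?thesis
    using u_rec main by blast
qed

end
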